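(* For every category of partitions $\mathcal C$ with $\langle\emptyset\rangle\subseteq\mathcal C\subseteq\mathcal I_\emptyset$ there exists a subsemigroup $D$ of $(\mathbb N_0,+)$ such that $\mathcal C=\mathcal I_D$. In particular, $\langle\emptyset\rangle=\mathcal I_{\mathbb N_0}$.
   Context: A (two-colored) partition $p$ consists of two finite totally ordered sets $U$ (upper row, left to right) and $L$ (lower row), a decomposition of $U\sqcup L$ (the points) into non-empty pairwise disjoint blocks, and a coloring of each point by $\circ$ or $\bullet$. A pair partition has only two-point blocks. Operations: tensor product $p\otimes p'$ (append the rows of $p'$ to the right of those of $p$); involution $p^*$ (exchange the rows); composition $pp'$, defined when the lower row of $p'$ and the upper row of $p$ agree in length and coloring: put $p'$ on top of $p$, identify the lower row of $p'$ with the upper row of $p$, keep the upper row of $p'$ and lower row of $p$, and let two remaining points be in the same block iff connected through blocks of $p,p'$ via the middle points (components entirely in the middle are discarded). A category of partitions is a set of partitions closed under these three operations and containing the partitions with one upper and one lower point of equal color $c\in\{\circ,\bullet\}$ forming a block, and the partitions with empty upper row and lower row $\circ\bullet$ resp. $\bullet\circ$ forming a block. $\langle\mathcal G\rangle$ is the smallest category containing $\mathcal G$. On the points of $p$ consider the cyclic order obtained by traversing the lower row left to right and then the upper row right to left. $]\alpha,\beta[$: points strictly after $\alpha$ and before $\beta$ in this cyclic order; $]\alpha,\beta]:=]\alpha,\beta[\cup\{\beta\}$ for $\alpha\ne\beta$, $]\alpha,\alpha]:=\emptyset$. Normalized color: the color for lower points, the opposite color for upper points. $\sigma_p(S)$ =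 #normalized-$\circ$ points of $S$ $-$ #normalized-$\bullet$ points of $S$. Distinct blocks $B,B'$ cross if there are $\alpha,\beta\in B,\gamma,\delta\in B'$ in cyclic order $\alpha,\gamma,\beta,\delta$. $\mathcal P^{\circ\bullet}_{2,\mathrm{nb}}$: pair partitions each block of which has one point of each normalized color. $\mathcal S_0$: those $p\in\mathcal P^{\circ\bullet}_{2,\mathrm{nb}}$ with $\sigma_p(]\alpha,\beta[)=0$ for all blocks $\{\alpha,\beta\}$. For $p\in\mathcal S_0$: $\delta_p(\alpha,\beta)=\sigma_p(]\alpha,\beta[)$ for different normalized colors, $\sigma_p(]\alpha,\beta])$ for equal ones; $d_p(B,B')=|\delta_p(\alpha,\alpha')|$ for any $\alpha\in B,\alpha'\in B'$ (well defined). A subsemigroup of $(\mathbb N_0,+)$ is a possibly empty subset closed under addition. $\mathcal I_D$: all $p\in\mathcal S_0$ with $d_p(B,B')\notin D$ for all crossing blocks $B,B'$. (Note $\mathcal I_\emptyset=\mathcal S_0$.) *)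

theory Defs
  imports Main
begin

datatype color = W | Bk

fun opp :: "color \<Rightarrow> color" where
  "opp W = Bk" | "opp Bk = W"

(* Up i = i-th upper point (0-based, left to right), Lo j = j-th lower point *)
datatype point = Up nat | Lo nat

record partition =
  up   :: "color list"
  lo   :: "color list"
  blks :: "point set set"

definition points :: "partition \<Rightarrow> point set" where
  "points p = {Up i | i. i < length (up p)} \<union> {Lo j | j. j < length (lo p)}"

definition wf_part :: "partition \<Rightarrow> bool" where
  "wf_part p \<longleftrightarrow> \<Union>(blks p) = points p \<and> (\<forall>B\<in>blks p. B \<noteq> {})
     \<and> (\<forall>B\<in>blks p. \<forall>B'\<in>blks p. B \<noteq> B' \<longrightarrow> B \<inter> B' = {})"

fun shift :: "nat \<Rightarrow> nat \<Rightarrow> point \<Rightarrow> point" where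
  "shift a b (Up i) = Up (i + a)" | "shift a b (Lo j) = Lo (j + b)"

definition tensor :: "partition \<Rightarrow> partition \<Rightarrow> partition" where
  "tensor p q = \<lparr>up = up p @ up q, lo = lo p @ lo q,
     blks = blks p \<union> (\<lambda>B. shift (length (up p)) (length (lo p)) ` B) ` blks q\<rparr>"

fun swp :: "point \<Rightarrow> point" where
  "swp (Up i) = Lo i" | "swp (Lo i) = Up i"

definition invol :: "partition \<Rightarrow> partition" where
  "invol p = \<lparr>up = lo p, lo = up p, blks = (\<lambda>B. swp ` B) ` blks p\<rparr>"

(* points in a composition: top row (of q), middle row, bottom row (of p) *)
datatype cpt = CT nat | CM nat | CB nat

fun topmap :: "point \<Rightarrow> cpt" where
  "topmap (Up i) = CT i" | "topmap (Lo i) = CM i"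

fun botmap :: "point \<Rightarrow> cpt" where
  "botmap (Up i) = CM i" | "botmap (Lo j) = CB j"

definition conn :: "partition \<Rightarrow> partition \<Rightarrow> (cpt \<times> cpt) set" where
  "conn p q = {(x, y). \<exists>B\<in>blks q. x \<in> topmap ` B \<and> y \<in> topmap ` B}
            \<union> {(x, y). \<exists>B\<in>blks p. x \<in> botmap ` B \<and> y \<in> botmap ` B}"

(* composition p q: q is put on top of p; meaningful when lo q = up p *)
definition comp :: "partition \<Rightarrow> partition \<Rightarrow> partition" where
  "comp p q = \<lparr>up = up q, lo = lo p,
     blks = {{Up i | i. (x, CT i) \<in> (conn p q)\<^sup>*} \<union> {Lo j | j. (x, CB j) \<in> (conn p q)\<^sup>*} | x.
              x \<in> CT ` {..<length (up q)} \<union> CB ` {..<length (lo p)}}\<rparr>"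

definition idp :: "color \<Rightarrow> partition" where
  "idp c = \<lparr>up = [c], lo = [c], blks = {{Up 0, Lo 0}}\<rparr>"

definition pairp :: "color \<Rightarrow> color \<Rightarrow> partition" where
  "pairp c c' = \<lparr>up = [], lo = [c, c'], blks = {{Lo 0, Lo 1}}\<rparr>"

definition category :: "partition set \<Rightarrow> bool" where
  "category C \<longleftrightarrow> C \<subseteq> Collect wf_part
     \<and> (\<forall>p\<in>C. \<forall>q\<in>C. tensor p q \<in> C)
     \<and> (\<forall>p\<in>C. invol p \<in> C)
     \<and> (\<forall>p\<in>C. \<forall>q\<in>C. lo q = up p \<longrightarrow> comp p q \<in> C)
     \<and> idp W \<in> C \<and> idp Bk \<in> C \<and> pairp W Bk \<in> C \<and> pairp Bk W \<in> C"

definition gen :: "partition set \<Rightarrow> partition set" where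
  "gen G = \<Inter>{C. category C \<and> G \<subseteq> C}"

(* position in the cyclic order: lower row left to right, then upper row right to left *)
fun pos :: "partition \<Rightarrow> point \<Rightarrow> int" where
  "pos p (Lo j) = int j"
| "pos p (Up i) = int (length (lo p)) + (int (length (up p)) - 1 - int i)"

definition npts :: "partition \<Rightarrow> int" where
  "npts p = int (length (up p) + length (lo p))"

definition cyc_open :: "partition \<Rightarrow> point \<Rightarrow> point \<Rightarrow> point set" where
  "cyc_open p a b = {c \<in> points p. 0 < (pos p c - pos p a) mod npts p
       \<and> (pos p c - pos p a) mod npts p < (pos p b - pos p a) mod npts p}"

(* ]a,b] ; empty for a = b *)
definition cyc_half :: "partition \<Rightarrow> point \<Rightarrow> point \<Rightarrow> point set" where
  "cyc_half p a b = {c \<in> points p. 0 < (pos p c - pos p a) mod npts p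
       \<and> (pos p c - pos p a) mod npts p \<le> (pos p b - pos p a) mod npts p}"

fun ncol :: "partition \<Rightarrow> point \<Rightarrow> color" where
  "ncol p (Lo j) = lo p ! j" | "ncol p (Up i) = opp (up p ! i)"

definition sigma :: "partition \<Rightarrow> point set \<Rightarrow> int" where
  "sigma p S = (\<Sum>x\<in>S. if ncol p x = W then 1 else -1)"

definition crosses :: "partition \<Rightarrow> point set \<Rightarrow> point set \<Rightarrow> bool" where
  "crosses p B B' \<longleftrightarrow> B \<noteq> B' \<and>
     (\<exists>\<alpha>\<in>B. \<exists>\<beta>\<in>B. \<exists>\<gamma>\<in>B'. \<exists>\<delta>\<in>B'. \<gamma> \<in> cyc_open p \<alpha> \<beta> \<and> \<delta> \<in> cyc_open p \<beta> \<alpha>)"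

definition pair_nb :: "partition \<Rightarrow> bool" where
  "pair_nb p \<longleftrightarrow> wf_part p \<and>
     (\<forall>B\<in>blks p. \<exists>\<alpha> \<beta>. B = {\<alpha>, \<beta>} \<and> ncol p \<alpha> \<noteq> ncol p \<beta>)"

definition S0 :: "partition set" where
  "S0 = {p. pair_nb p \<and>
     (\<forall>B\<in>blks p. \<forall>\<alpha>\<in>B. \<forall>\<beta>\<in>B. \<alpha> \<noteq> \<beta> \<longrightarrow> sigma p (cyc_open p \<alpha> \<beta>) = 0)}"

definition delta :: "partition \<Rightarrow> point \<Rightarrow> point \<Rightarrow> int" where
  "delta p a b = (if ncol p a \<noteq> ncol p b then sigma p (cyc_open p a b)
                  else sigma p (cyc_half p a b))"

(* d_p(B,B') = |delta_p(a,a')| for any a in B, a' in B' *)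
definition dist :: "partition \<Rightarrow> point set \<Rightarrow> point set \<Rightarrow> nat" where
  "dist p B B' = nat \<bar>delta p (SOME a. a \<in> B) (SOME a'. a' \<in> B')\<bar>"

definition ID :: "nat set \<Rightarrow> partition set" where
  "ID D = {p \<in> S0. \<forall>B\<in>blks p. \<forall>B'\<in>blks p. crosses p B B' \<longrightarrow> dist p B B' \<notin> D}"

definition subsemigroup :: "nat set \<Rightarrow> bool" where
  "subsemigroup D \<longleftrightarrow> (\<forall>x\<in>D. \<forall>y\<in>D. x + y \<in> D)"

end

theory Submission
  imports Defs "HOL-Library.Sublist"
begin

text \<open>Label the blocks of a partition. Reading \<open>\<circ>\<close> and \<open>\<bullet>\<close> as a generator and its inverse, a category
  becomes a congruence on labelled words whose quotient is a group: two words are congruent if they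
  are the rows of a member of the category with labels constant on blocks. Give one label \<open>z\<close> to
  auxiliary points. A block of level \<open>k\<close> labelled \<open>l\<close> then corresponds to \<open>z^k l z^(-k-1)\<close>, and a
  partition in \<open>S0\<close> has as its word a product of these elements and their inverses, paired by the blocks.
  A member with crossing blocks of levels \<open>k\<close>, \<open>k'\<close> says exactly that the elements of these levels
  commute, hence so do all those of levels at the same distance. If all crossing distances of a
  partition in \<open>S0\<close> occur in the category, the commutations reduce its word to 1, so it is a member.
  The complement \<open>D\<close> of the set of crossing distances is a semigroup because a crossing of blocks at
  distance \<open>x + y\<close> forces a block at distance \<open>x\<close> from one and \<open>y\<close> from the other to cross one of them.\<close>

section \<open>Labelled words of a partition\<close>

text \<open>Membership \<open>p \<in> C\<close> is hard to reach directly, since a composition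
  changes all blocks at once. Labels turn it into a word problem. If every point of \<open>p\<close>
  carries its own block as label, then triviality of the labelled word yields some member of
  \<open>C\<close> with the rows of \<open>p\<close> whose blocks lie inside those of
  \<open>p\<close>. Both consist of two-point blocks, by \<open>C \<subseteq> S0\<close>, so they
  coincide. The auxiliary label serves the opposite direction: in a given member, all blocks except
  two crossing ones are merged into one generator, so a stretch between marked points is remembered
  only by its height, and what remains is a commutator. The claim about \<open>gen {}\<close> needs
  \<open>gen {} \<subseteq> S0\<close>. As \<open>gen {}\<close> is an intersection, this requires
  exhibiting some category inside \<open>S0\<close>. Heights and crossings are awkward to follow
  through a composition, whereas equality of two actions passes through the common middle row at
  once; testing the action with few labels recovers every condition except the size of the
  blocks.\<close>

definition upw :: "partition \<Rightarrow> (point \<Rightarrow> 'l) \<Rightarrow> (color \<times> 'l) list" where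
  "upw p \<phi> = map (\<lambda>i. (up p ! i, \<phi> (Up i))) [0..<length (up p)]"

definition low :: "partition \<Rightarrow> (point \<Rightarrow> 'l) \<Rightarrow> (color \<times> 'l) list" where
  "low p \<phi> = map (\<lambda>j. (lo p ! j, \<phi> (Lo j))) [0..<length (lo p)]"

definition block_const :: "partition \<Rightarrow> (point \<Rightarrow> 'l) \<Rightarrow> bool" where
  "block_const p \<phi> \<longleftrightarrow> (\<forall>B\<in>blks p. \<forall>P\<in>B. \<forall>Q\<in>B. \<phi> P = \<phi> Q)"

text \<open>Distinct blocks may carry equal labels. A single member of \<open>C\<close> therefore
  gives one relation for every choice of labels of its blocks, and blocks can be merged by giving
  them the same label.\<close>

definition hom :: "partition set \<Rightarrow> (color \<times> 'l) list \<Rightarrow> (color \<times> 'l) list \<Rightarrow> bool" where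
  "hom C x y \<longleftrightarrow> (\<exists>p\<in>C. \<exists>\<phi>. block_const p \<phi> \<and> x = upw p \<phi> \<and> y = low p \<phi>)"

lemma block_constD: "block_const p \<phi> \<Longrightarrow> B \<in> blks p \<Longrightarrow> P \<in> B \<Longrightarrow> Q \<in> B \<Longrightarrow> \<phi> P = \<phi> Q"
  unfolding block_const_def by blast

lemma length_upw [simp]: "length (upw p \<phi>) = length (up p)"
  and length_low [simp]: "length (low p \<phi>) = length (lo p)"
  by (auto simp: upw_def low_def)

lemma map_fst_upw [simp]: "map fst (upw p \<phi>) = up p"
  and map_fst_low [simp]: "map fst (low p \<phi>) = lo p"
  by (auto simp: upw_def low_def intro: nth_equalityI)

lemma nth_upw: "i < length (up p) \<Longrightarrow> upw p \<phi> ! i = (up p ! i, \<phi> (Up i))"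
  and nth_low: "j < length (lo p) \<Longrightarrow> low p \<phi> ! j = (lo p ! j, \<phi> (Lo j))"
  by (auto simp: upw_def low_def)

lemma wf_partD:
  assumes "wf_part p" "B \<in> blks p"
  shows "B \<subseteq> points p" "B \<noteq> {}"
  using assms by (auto simp: wf_part_def)

lemma wf_part_eq: "wf_part p \<Longrightarrow> B \<in> blks p \<Longrightarrow> B' \<in> blks p \<Longrightarrow> P \<in> B \<Longrightarrow> P \<in> B' \<Longrightarrow> B = B'"
  unfolding wf_part_def by blast

lemma upw_invol: "upw (invol p) \<phi> = low p (\<phi> \<circ> swp)"
  and low_invol: "low (invol p) \<phi> = upw p (\<phi> \<circ> swp)"
  by (auto simp: upw_def low_def invol_def)

lemma block_const_invol: "block_const (invol p) \<phi> \<longleftrightarrow> block_const p (\<phi> \<circ> swp)"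
  by (auto simp: block_const_def invol_def)

lemma upw_tensor:
  "upw (tensor p q) \<phi> = upw p \<phi> @ upw q (\<phi> \<circ> shift (length (up p)) (length (lo p)))"
  by (rule nth_equalityI) (auto simp: upw_def tensor_def nth_append)

lemma low_tensor:
  "low (tensor p q) \<phi> = low p \<phi> @ low q (\<phi> \<circ> shift (length (up p)) (length (lo p)))"
  by (rule nth_equalityI) (auto simp: low_def tensor_def nth_append)

lemma block_const_tensor:
  "block_const (tensor p q) \<phi> \<longleftrightarrow>
     block_const p \<phi> \<and> block_const q (\<phi> \<circ> shift (length (up p)) (length (lo p)))"
  by (simp add: block_const_def tensor_def ball_Un)

lemma up_comp [simp]: "up (comp p q) = up q" and lo_comp [simp]: "lo (comp p q) = lo p"
  by (auto simp: comp_def)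

text \<open>A labelling of all three rows that is constant along each edge is constant on connected
  components, and the blocks of a composition are the traces of components.\<close>

lemma block_const_comp:
  assumes \<psi>: "\<And>x y. (x, y) \<in> conn p q \<Longrightarrow> \<psi> x = \<psi> y"
  shows "block_const (comp p q) (\<lambda>P. case P of Up i \<Rightarrow> \<psi> (CT i) | Lo j \<Rightarrow> \<psi> (CB j))"
proof -
  have "\<psi> x = \<psi> y" if "(x, y) \<in> (conn p q)\<^sup>*" for x y
    using that by (induction rule: rtrancl_induct) (auto dest: \<psi>)
  then have eq: "\<psi> y = \<psi> z" if "(x, y) \<in> (conn p q)\<^sup>*" "(x, z) \<in> (conn p q)\<^sup>*" for x y z
    using that by metis
  show ?thesis
    unfolding block_const_def
  proof (intro ballI)
    fix B P Q
    assume B: "B \<in> blks (comp p q)" "P \<in> B" "Q \<in> B"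
    then obtain x where "B = {Up i | i. (x, CT i) \<in> (conn p q)\<^sup>*} \<union> {Lo j | j. (x, CB j) \<in> (conn p q)\<^sup>*}"
      unfolding comp_def by auto
    with B(2,3) show "(case P of Up i \<Rightarrow> \<psi> (CT i) | Lo j \<Rightarrow> \<psi> (CB j))
        = (case Q of Up i \<Rightarrow> \<psi> (CT i) | Lo j \<Rightarrow> \<psi> (CB j))"
      by (cases P; cases Q) (auto intro: eq)
  qed
qed

lemma swp_swp [simp]: "swp (swp P) = P"
  by (cases P) auto

lemma hom_sym:
  assumes C: "category C" and h: "hom C x y"
  shows "hom C y x"
proof -
  from h obtain p \<phi> where p: "p \<in> C" "block_const p \<phi>" "x = upw p \<phi>" "y = low p \<phi>"
    by (auto simp: hom_def)
  have "\<phi> \<circ> swp \<circ> swp = \<phi>" by (simp add: fun_eq_iff)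
  moreover have "invol p \<in> C" using C p(1) by (auto simp: category_def)
  ultimately show ?thesis
    unfolding hom_def using p
    by (intro bexI[of _ "invol p"] exI[of _ "\<phi> \<circ> swp"]) (auto simp: block_const_invol upw_invol low_invol)
qed

lemma conn_cases:
  assumes "wf_part p" "wf_part q" "(x, y) \<in> conn p q"
  obtains B P Q where "B \<in> blks q" "P \<in> B" "Q \<in> B" "x = topmap P" "y = topmap Q"
    "P \<in> points q" "Q \<in> points q"
  | B P Q where "B \<in> blks p" "P \<in> B" "Q \<in> B" "x = botmap P" "y = botmap Q"
    "P \<in> points p" "Q \<in> points p"
proof -
  from assms(3) consider "\<exists>B\<in>blks q. x \<in> topmap ` B \<and> y \<in> topmap ` B"
    | "\<exists>B\<in>blks p. x \<in> botmap ` B \<and> y \<in> botmap ` B"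
    by (auto simp: conn_def)
  then show thesis
  proof cases
    case 1
    then obtain B P Q where B: "B \<in> blks q" "P \<in> B" "Q \<in> B" "x = topmap P" "y = topmap Q" by blast
    then have "P \<in> points q" "Q \<in> points q" using wf_partD(1)[OF assms(2)] by auto
    with B show thesis by (rule that(1))
  next
    case 2
    then obtain B P Q where B: "B \<in> blks p" "P \<in> B" "Q \<in> B" "x = botmap P" "y = botmap Q" by blast
    then have "P \<in> points p" "Q \<in> points p" using wf_partD(1)[OF assms(1)] by auto
    with B show thesis by (rule that(2))
  qed
qed

text \<open>The shared word \<open>y\<close> forces equal colors and equal labels along the middle
  row, so the two labellings glue to one labelling of three rows.\<close>

lemma hom_trans:
  assumes C: "category C" and xy: "hom C x y" and yz: "hom C y z"
  shows "hom C x z"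
proof -
  from xy obtain q \<phi> where q: "q \<in> C" "block_const q \<phi>" "x = upw q \<phi>" "y = low q \<phi>"
    by (auto simp: hom_def)
  from yz obtain p \<chi> where p: "p \<in> C" "block_const p \<chi>" "y = upw p \<chi>" "z = low p \<chi>"
    by (auto simp: hom_def)
  have wf: "wf_part p" "wf_part q" using C p(1) q(1) by (auto simp: category_def)
  have lu: "lo q = up p" using q(4) p(3) by (metis map_fst_upw map_fst_low)
  then have "comp p q \<in> C" using C p(1) q(1) by (auto simp: category_def)
  have mid: "\<phi> (Lo i) = \<chi> (Up i)" if "i < length (up p)" for i
    using that nth_upw[of i p \<chi>] nth_low[of i q \<phi>] p(3) q(4) lu by simp
  define \<psi> where "\<psi> u = (case u of CT i \<Rightarrow> \<phi> (Up i) | CM i \<Rightarrow> \<phi> (Lo i) | CB j \<Rightarrow> \<chi> (Lo j))" for u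
  have top: "\<psi> (topmap P) = \<phi> P" for P by (cases P) (auto simp: \<psi>_def)
  have bot: "\<psi> (botmap P) = \<chi> P" if "P \<in> points p" for P
    using that mid by (cases P) (auto simp: \<psi>_def points_def)
  have "\<psi> u = \<psi> v" if "(u, v) \<in> conn p q" for u v
    using wf that
    by (cases rule: conn_cases) (metis top bot block_constD q(2) p(2))+
  then have "block_const (comp p q) (\<lambda>P. case P of Up i \<Rightarrow> \<psi> (CT i) | Lo j \<Rightarrow> \<psi> (CB j))"
    by (rule block_const_comp)
  then show ?thesis
    unfolding hom_def using \<open>comp p q \<in> C\<close> q(3) p(4)
    by (intro bexI[of _ "comp p q"] exI) (auto simp: upw_def low_def \<psi>_def)
qed

lemma hom_append:
  assumes C: "category C" and 1: "hom C x y" and 2: "hom C x' y'"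
  shows "hom C (x @ x') (y @ y')"
proof -
  from 1 obtain p \<phi> where p: "p \<in> C" "block_const p \<phi>" "x = upw p \<phi>" "y = low p \<phi>"
    by (auto simp: hom_def)
  from 2 obtain q \<chi> where q: "q \<in> C" "block_const q \<chi>" "x' = upw q \<chi>" "y' = low q \<chi>"
    by (auto simp: hom_def)
  let ?u = "length (up p)" and ?l = "length (lo p)"
  define \<psi> where "\<psi> P = (case P of Up i \<Rightarrow> if i < ?u then \<phi> P else \<chi> (Up (i - ?u))
     | Lo i \<Rightarrow> if i < ?l then \<phi> P else \<chi> (Lo (i - ?l)))" for P
  have sh: "\<psi> \<circ> shift ?u ?l = \<chi>"
  proof
    show "(\<psi> \<circ> shift ?u ?l) P = \<chi> P" for P by (cases P) (auto simp: \<psi>_def)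
  qed
  have pt: "\<psi> P = \<phi> P" if "P \<in> points p" for P
    using that by (auto simp: \<psi>_def points_def)
  have "wf_part p" using C p(1) by (auto simp: category_def)
  then have "block_const p \<psi>"
    using p(2) pt unfolding block_const_def by (metis wf_partD(1) subsetD)
  moreover have "upw p \<psi> = x" "low p \<psi> = y"
    using pt by (auto simp: p(3,4) upw_def low_def points_def)
  moreover have "tensor p q \<in> C" using C p(1) q(1) by (auto simp: category_def)
  ultimately show ?thesis
    unfolding hom_def using q
    by (intro bexI[of _ "tensor p q"] exI[of _ \<psi>]) (auto simp: block_const_tensor upw_tensor low_tensor sh)
qed

lemma hom_pairp:
  assumes "category C"
  shows "hom C [] [(c, l), (opp c, l)]"
proof -
  have "pairp c (opp c) \<in> C" using assms by (cases c) (auto simp: category_def)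
  then show ?thesis
    unfolding hom_def
    by (intro bexI[of _ "pairp c (opp c)"] exI[of _ "\<lambda>_. l"])
      (auto simp: block_const_def upw_def low_def pairp_def)
qed

lemma hom_refl:
  assumes C: "category C"
  shows "hom C x x"
proof (induction x)
  case Nil
  \<comment> \<open>The empty partition is not one of the prescribed members. It arises by composing
    a pair with its involution, where the closed middle component is discarded.\<close>
  show ?case by (rule hom_trans[OF C hom_pairp hom_sym[OF C hom_pairp]]) (rule C)+
next
  case (Cons a x)
  have "idp (fst a) \<in> C" using C by (cases "fst a") (auto simp: category_def)
  then have "hom C [a] [a]"
    unfolding hom_def
    by (intro bexI[of _ "idp (fst a)"] exI[of _ "\<lambda>_. snd a"])
      (auto simp: block_const_def upw_def low_def idp_def)
  from hom_append[OF C this Cons] show ?case by simp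
qed

section \<open>Congruences on labelled words\<close>

lemma subseq_four: "subseq [a, b, c, d] (u1 @ a # u2 @ b # u3 @ c # u4 @ d # u5)"
  by (intro list_emb_append2 subseq_Cons2 list_emb_Nil)

fun sg :: "color \<Rightarrow> int" where
  "sg W = 1" | "sg Bk = - 1"

lemma opp_opp [simp]: "opp (opp c) = c" by (cases c) auto

lemma sg_opp [simp]: "sg (opp c) = - sg c" by (cases c) auto

lemma opp_neq [simp]: "opp c \<noteq> c" "c \<noteq> opp c" by (cases c; simp)+

lemma neq_opp: "c \<noteq> d \<longleftrightarrow> d = opp c" by (cases c; cases d; simp)

abbreviation ht :: "color list \<Rightarrow> int" where
  "ht cs \<equiv> sum_list (map sg cs)"

definition winv :: "(color \<times> 'l) list \<Rightarrow> (color \<times> 'l) list" where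
  "winv w = rev (map (\<lambda>(c, l). (opp c, l)) w)"

lemma winv_Nil [simp]: "winv [] = []"
  and winv_Cons: "winv ((c, l) # w) = winv w @ [(opp c, l)]"
  by (auto simp: winv_def)

lemma winv_winv [simp]: "winv (winv w) = w"
  by (simp add: winv_def rev_map o_def case_prod_beta)

locale word_congruence =
  fixes R :: "(color \<times> 'l) list \<Rightarrow> (color \<times> 'l) list \<Rightarrow> bool" (infix "\<approx>" 50)
  assumes R_refl [simp, intro]: "x \<approx> x"
    and R_sym: "x \<approx> y \<Longrightarrow> y \<approx> x"
    and R_trans [trans]: "x \<approx> y \<Longrightarrow> y \<approx> z \<Longrightarrow> x \<approx> z"
    and R_append: "x \<approx> y \<Longrightarrow> x' \<approx> y' \<Longrightarrow> x @ x' \<approx> y @ y'"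
    and R_cancel: "[(c, l), (opp c, l)] \<approx> []"
begin

lemma R_context: "x \<approx> y \<Longrightarrow> u @ x @ v \<approx> u @ y @ v"
  by (simp add: R_append)

lemma R_delete: "x \<approx> [] \<Longrightarrow> u @ x @ v \<approx> u @ v"
  using R_context[of x "[]"] by simp

lemma R_winv: "w @ winv w \<approx> []"
proof (induction w)
  case (Cons a w)
  obtain c l where a: "a = (c, l)" by force
  have "[a] @ (w @ winv w) @ [(opp c, l)] \<approx> [a] @ [(opp c, l)]" by (rule R_delete) (rule Cons)
  also have "\<dots> \<approx> []" using R_cancel[of c l] a by simp
  finally show ?case by (simp add: a winv_Cons)
qed simp

lemma R_winv': "winv w @ w \<approx> []"
  using R_winv[of "winv w"] by simp

lemma R_from_trivial:
  assumes "w @ winv x \<approx> []"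
  shows "w \<approx> x"
proof -
  have 1: "w @ winv x @ x \<approx> w" using R_delete[OF R_winv', of w x "[]"] by simp
  have "w @ winv x @ x \<approx> x" using R_delete[OF assms, of "[]" x] by simp
  with R_sym[OF 1] show ?thesis by (rule R_trans)
qed

lemma R_to_trivial:
  assumes "w \<approx> x"
  shows "w @ winv x \<approx> []"
  by (rule R_trans[OF R_append[OF assms R_refl] R_winv])

text \<open>Appending \<open>X' @ X\<close> to \<open>X @ Y\<close> and inserting
  \<open>Y' @ Y\<close> before the last \<open>X\<close> exposes the commutator, whose deletion
  leaves \<open>Y @ X\<close>.\<close>

lemma R_commutator:
  assumes "X @ Y @ X' @ Y' \<approx> []" "Y' @ Y \<approx> []" "X' @ X \<approx> []"
  shows "X @ Y \<approx> Y @ X"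
proof -
  have "X @ Y @ (X' @ X) \<approx> X @ Y" using R_delete[OF assms(3), of "X @ Y" "[]"] by simp
  then have "X @ Y \<approx> X @ Y @ X' @ X" by (rule R_sym)
  also have "\<dots> \<approx> X @ Y @ X' @ Y' @ Y @ X"
    using R_sym[OF R_delete[OF assms(2), of "X @ Y @ X'" X]] by simp
  also have "\<dots> \<approx> Y @ X" using R_delete[OF assms(1), of "[]" "Y @ X"] by simp
  finally show ?thesis .
qed

lemma R_commute_inverse:
  assumes c: "X @ Y \<approx> Y @ X" and "X' @ X \<approx> []" "X @ X' \<approx> []"
  shows "X' @ Y \<approx> Y @ X'"
proof -
  have "X' @ Y \<approx> X' @ Y @ X @ X'"
    using R_sym[OF R_delete[OF assms(3), of "X' @ Y" "[]"]] by simp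
  also have "\<dots> \<approx> X' @ X @ Y @ X'" using R_context[OF R_sym[OF c], of X' X'] by simp
  also have "\<dots> \<approx> Y @ X'" using R_delete[OF assms(2), of "[]" "Y @ X'"] by simp
  finally show ?thesis .
qed

lemma R_commute_product:
  assumes "\<And>x. x \<in> set xs \<Longrightarrow> X @ G x \<approx> G x @ X"
  shows "X @ concat (map G xs) \<approx> concat (map G xs) @ X"
  using assms
proof (induction xs)
  case (Cons x xs)
  have "X @ G x @ concat (map G xs) \<approx> G x @ X @ concat (map G xs)"
    using R_append[OF Cons.prems[of x] R_refl[of "concat (map G xs)"]] by simp
  also have "\<dots> \<approx> G x @ concat (map G xs) @ X"
    using R_append[OF R_refl[of "G x"] Cons.IH] Cons.prems by simp
  finally show ?case by simp
qed simp

text \<open>A shortest chord is crossed by every chord ending underneath it, so its left end can be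
  moved next to its right end, where the two cancel.\<close>

lemma R_chords:
  fixes G :: "color \<times> 'i \<Rightarrow> (color \<times> 'l) list"
  assumes canc: "\<And>c i. G (c, i) @ G (opp c, i) \<approx> []"
    and "distinct xs"
    and "\<And>c i. (c, i) \<in> set xs \<Longrightarrow> (opp c, i) \<in> set xs"
    and "\<And>c c' i j. i \<noteq> j \<Longrightarrow> subseq [(c, i), (c', j), (opp c, i), (opp c', j)] xs \<Longrightarrow>
           (\<forall>d d'. G (d, i) @ G (d', j) \<approx> G (d', j) @ G (d, i))"
  shows "concat (map G xs) \<approx> []"
  using assms(2-)
proof (induction "length xs" arbitrary: xs rule: less_induct)
  case less
  show ?case
  proof (cases xs)
    case (Cons x ys)
    define Q where "Q n \<longleftrightarrow> (\<exists>u c i v w. xs = u @ (c, i) # v @ (opp c, i) # w \<and> length v = n)" for n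
    have QI: "Q (length v)" if "xs = u @ (c, i) # v @ (opp c, i) # w" for u c i v w
      unfolding Q_def using that by blast
    obtain c i where x: "x = (c, i)" by force
    have "(opp c, i) \<in> set ys" using less.prems(2)[of c i] Cons x by auto
    then obtain v w where "ys = v @ (opp c, i) # w" by (meson split_list)
    then have "Q (length v)" using QI[of "[]"] Cons x by simp
    then have "Q (LEAST n. Q n)" by (rule LeastI)
    then obtain u c i v w where xs: "xs = u @ (c, i) # v @ (opp c, i) # w"
      and len: "length v = (LEAST n. Q n)"
      unfolding Q_def by blast
    have comm: "G (c, i) @ G y \<approx> G y @ G (c, i)" if yv: "y \<in> set v" for y
    proof -
      obtain c' j where y: "y = (c', j)" by force
      obtain v1 v2 where v: "v = v1 @ (c', j) # v2" using yv y by (meson split_list)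
      have "(c', j) \<noteq> (c, i)" "(c', j) \<noteq> (opp c, i)" using less.prems(1) xs v by auto
      then have ij: "i \<noteq> j" using neq_opp by metis
      have nv: "(opp c', j) \<notin> set v"
      proof
        assume "(opp c', j) \<in> set v"
        then consider "(opp c', j) \<in> set v1" | "(opp c', j) \<in> set v2" using v by auto
        then have "\<exists>n<length v. Q n"
        proof cases
          case 1
          then obtain a b where "v1 = a @ (opp c', j) # b" by (meson split_list)
          then have "xs = (u @ (c, i) # a) @ (opp c', j) # b @ (opp (opp c'), j) # (v2 @ (opp c, i) # w)"
            "length b < length v" using xs v by auto
          then show ?thesis using QI by blast
        next
          case 2
          then obtain a b where "v2 = a @ (opp c', j) # b" by (meson split_list)
          then have "xs = (u @ (c, i) # v1) @ (c', j) # a @ (opp c', j) # (b @ (opp c, i) # w)"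
            "length a < length v" using xs v by auto
          then show ?thesis using QI by blast
        qed
        then show False using len not_less_Least by metis
      qed
      have "(opp c', j) \<in> set xs" using less.prems(2)[of c' j] xs v by auto
      then consider "(opp c', j) \<in> set u" | "(opp c', j) \<in> set w" using xs nv ij by auto
      then show ?thesis
      proof cases
        case 1
        then obtain a b where "u = a @ (opp c', j) # b" by (meson split_list)
        then have "subseq [(opp c', j), (c, i), (opp (opp c'), j), (opp c, i)] xs"
          using xs v by (simp add: subseq_four)
        \<comment> \<open>The chord \<open>j\<close> starts further left here, so it takes the first
          role in the hypothesis and \<open>(c', j)\<close> is its right end.\<close>
        from less.prems(3)[OF ij[symmetric] this] show ?thesis unfolding y by (intro R_sym[of "G (c', j) @ _"]) blast
      next
        case 2
        then obtain a b where "w = a @ (opp c', j) # b" by (meson split_list)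
        then have "subseq [(c, i), (c', j), (opp c, i), (opp c', j)] xs"
          using xs v by (simp add: subseq_four)
        from less.prems(3)[OF ij this] show ?thesis unfolding y by blast
      qed
    qed
    let ?P = "\<lambda>xs. concat (map G xs)"
    have "G (c, i) @ ?P v \<approx> ?P v @ G (c, i)" using comm by (rule R_commute_product)
    from R_context[OF this, of "?P u" "G (opp c, i) @ ?P w"]
    have "?P xs \<approx> ?P u @ ?P v @ G (c, i) @ G (opp c, i) @ ?P w" using xs by simp
    also have "\<dots> \<approx> ?P (u @ v @ w)"
      using R_delete[OF canc[of c i], of "?P u @ ?P v" "?P w"] by simp
    also have "\<dots> \<approx> []"
    proof (rule less.hyps)
      \<comment> \<open>Deleting a chord creates no new crossing, so commutation passes to the
        shorter list.\<close>
      have sub: "subseq (u @ v @ w) xs" using xs by (auto intro: list_emb_append_mono)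
      show "length (u @ v @ w) < length xs" using xs by simp
      show "distinct (u @ v @ w)" using less.prems(1) xs by auto
      show "(opp d, j) \<in> set (u @ v @ w)" if "(d, j) \<in> set (u @ v @ w)" for d j
      proof -
        have "(d, j) \<noteq> (c, i)" "(d, j) \<noteq> (opp c, i)" using that less.prems(1) xs by auto
        then have "(opp d, j) \<noteq> (c, i)" "(opp d, j) \<noteq> (opp c, i)" by (metis opp_opp prod.inject)+
        moreover have "(opp d, j) \<in> set xs" using less.prems(2)[of d j] that xs by auto
        ultimately show ?thesis using xs by auto
      qed
      show "\<forall>d d'. G (d, i) @ G (d', j) \<approx> G (d', j) @ G (d, i)"
        if "i \<noteq> j" "subseq [(c, i), (c', j), (opp c, i), (opp c', j)] (u @ v @ w)" for c c' i j
        using less.prems(3)[OF that(1) subseq_order.trans[OF that(2) sub]] .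
    qed
    finally show ?thesis .
  qed simp
qed

end

text \<open>The height at which a step of the given color and level starts.\<close>

fun lh :: "color \<Rightarrow> int \<Rightarrow> int" where
  "lh W k = k" | "lh Bk k = k + 1"

lemma lh_opp: "lh (opp c) k = lh c k + sg c"
  by (cases c) auto

text \<open>The power \<open>z ^ k\<close> of the auxiliary generator as a reduced word: at most one
  of the two factors is nonempty.\<close>

definition zw :: "int \<Rightarrow> (color \<times> 'l option) list" where
  "zw k = replicate (nat k) (W, None) @ replicate (nat (- k)) (Bk, None)"

text \<open>A point of level \<open>k\<close>, color \<open>c\<close> and label \<open>l\<close>, completed by auxiliary points (label \<open>None\<close>) to a walk
  from 0 to 0.\<close>

definition gl :: "int \<Rightarrow> color \<Rightarrow> 'l \<Rightarrow> (color \<times> 'l option) list" where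
  "gl k c l = zw (lh c k) @ [(c, Some l)] @ zw (- lh (opp c) k)"

lemma zw_0 [simp]: "zw 0 = []"
  by (simp add: zw_def)

lemma ht_zw: "ht (map fst (zw k)) = k"
  by (simp add: zw_def sum_list_replicate)

lemma snd_zw: "x \<in> set (zw k) \<Longrightarrow> snd x = None"
  by (auto simp: zw_def)

section \<open>Powers of the auxiliary generator and conjugated letters\<close>

locale height_words = word_congruence R
  for R :: "(color \<times> 'l option) list \<Rightarrow> (color \<times> 'l option) list \<Rightarrow> bool" (infix "\<approx>" 50)
begin

text \<open>A step away from 0 lengthens the power; a step towards 0 cancels against its first
  letter.\<close>

lemma R_zw_step: "(c, None) # zw k \<approx> zw (sg c + k)"
proof -
  have del: "(c, None) # (opp c, None) # x \<approx> x" for x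
    using R_delete[OF R_cancel, of "[]" c None x] by simp
  show ?thesis
  proof (cases c)
    case W
    show ?thesis
    proof (cases "k \<ge> 0")
      case True
      then have "nat (1 + k) = Suc (nat k)" by simp
      then show ?thesis using True W by (simp add: zw_def)
    next
      case False
      then have "nat (- k) = Suc (nat (- 1 - k))" by simp
      then show ?thesis using False W del[of "zw (1 + k)"] by (simp add: zw_def)
    qed
  next
    case Bk
    show ?thesis
    proof (cases "k \<le> 0")
      case True
      then have "nat (1 - k) = Suc (nat (- k))" by simp
      then show ?thesis using True Bk by (simp add: zw_def)
    next
      case False
      then have "nat k = Suc (nat (k - 1))" by simp
      then show ?thesis using False Bk del[of "zw (k - 1)"] by (simp add: zw_def)
    qed
  qed
qed

text \<open>This is the gain from a common label for all auxiliary points: a stretch of them is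
  determined by its height.\<close>

lemma R_zw: "(\<And>x. x \<in> set w \<Longrightarrow> snd x = None) \<Longrightarrow> w \<approx> zw (ht (map fst w))"
proof (induction w)
  case (Cons x w)
  obtain c where x: "x = (c, None)" using Cons.prems[of x] by (cases x) auto
  have "[x] @ w \<approx> [x] @ zw (ht (map fst w))"
    using Cons by (intro R_append) auto
  also have "\<dots> \<approx> zw (sg c + ht (map fst w))" using R_zw_step x by simp
  finally show ?case using x by simp
qed simp

lemma R_zw_add: "zw a @ zw b \<approx> zw (a + b)"
proof -
  have "zw a @ zw b \<approx> zw (ht (map fst (zw a @ zw b :: (color \<times> 'l option) list)))"
    by (rule R_zw) (auto dest: snd_zw)
  then show ?thesis by (simp only: map_append sum_list_append ht_zw)
qed

lemma R_zw_merge: "a + b = c \<Longrightarrow> u @ zw a @ zw b @ v \<approx> u @ zw c @ v"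
  using R_context[OF R_zw_add, of u a b v] by simp

lemma R_zw_delete: "a + b = 0 \<Longrightarrow> u @ zw a @ zw b @ v \<approx> u @ v"
  using R_zw_merge[of a b 0 u v] by simp

text \<open>A step of color \<open>c\<close> on the edge \<open>k\<close> ends at height
  \<open>lh (opp c) k\<close>, where the opposite step starts. Hence the two inner powers cancel,
  then the marked letters, then the outer powers.\<close>

lemma gl_cancel: "gl k c l @ gl k (opp c) l \<approx> []"
proof -
  have "gl k c l @ gl k (opp c) l \<approx> (zw (lh c k) @ [(c, Some l)]) @ [(opp c, Some l)] @ zw (- lh c k)"
    using R_zw_delete[of "- lh (opp c) k" "lh (opp c) k" "zw (lh c k) @ [(c, Some l)]"]
    by (simp add: gl_def)
  also have "\<dots> \<approx> zw (lh c k) @ zw (- lh c k)"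
    using R_delete[OF R_cancel[of c "Some l"]] by simp
  also have "\<dots> \<approx> []" using R_zw_delete[of "lh c k" "- lh c k" "[]" "[]"] by simp
  finally show ?thesis .
qed

lemma gl_cancel': "gl k (opp c) l @ gl k c l \<approx> []"
  using gl_cancel[of k "opp c"] by simp

text \<open>Raising the level is conjugation by a power of \<open>z\<close>. As conjugation respects
  products, commutation can depend only on the difference of the levels.\<close>

lemma gl_shift: "gl (k + j) c l \<approx> zw j @ gl k c l @ zw (- j)"
proof -
  have lh: "lh c (k + j) = lh c k + j" for c by (cases c) auto
  have "zw j @ gl k c l @ zw (- j) \<approx> zw (lh c (k + j)) @ [(c, Some l)] @ zw (- lh (opp c) k) @ zw (- j)"
    using R_zw_merge[of j "lh c k" "lh c (k + j)" "[]"] by (simp add: gl_def lh)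
  also have "\<dots> \<approx> gl (k + j) c l"
    using R_zw_merge[of "- lh (opp c) k" "- j" "- lh (opp c) (k + j)" "zw (lh c (k + j)) @ [(c, Some l)]" "[]"]
    by (simp add: gl_def lh)
  finally show ?thesis by (rule R_sym)
qed

definition commute :: "int \<Rightarrow> int \<Rightarrow> bool" where
  "commute k k' \<longleftrightarrow> (\<forall>c c' l m. gl k c l @ gl k' c' m \<approx> gl k' c' m @ gl k c l)"

lemma commute_sym: "commute k k' \<Longrightarrow> commute k' k"
  unfolding commute_def using R_sym by blast

lemma commute_shift:
  assumes "commute k k'"
  shows "commute (k + j) (k' + j)"
proof -
  have prod: "gl (a + j) c l @ gl (b + j) c' m \<approx> zw j @ (gl a c l @ gl b c' m) @ zw (- j)" for a b c c' l m
  proof -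
    have "gl (a + j) c l @ gl (b + j) c' m
        \<approx> (zw j @ gl a c l @ zw (- j)) @ (zw j @ gl b c' m @ zw (- j))"
      by (intro R_append gl_shift)
    also have "\<dots> \<approx> zw j @ (gl a c l @ gl b c' m) @ zw (- j)"
      using R_zw_delete[of "- j" j "zw j @ gl a c l"] by simp
    finally show ?thesis .
  qed
  show ?thesis
    unfolding commute_def
  proof (intro allI)
    fix c c' l m
    have "gl (k + j) c l @ gl (k' + j) c' m \<approx> zw j @ (gl k c l @ gl k' c' m) @ zw (- j)"
      by (rule prod)
    also have "\<dots> \<approx> zw j @ (gl k' c' m @ gl k c l) @ zw (- j)"
      using assms by (intro R_context) (auto simp: commute_def)
    also have "\<dots> \<approx> gl (k' + j) c' m @ gl (k + j) c l" by (rule R_sym[OF prod])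
    finally show "gl (k + j) c l @ gl (k' + j) c' m \<approx> gl (k' + j) c' m @ gl (k + j) c l" .
  qed
qed

lemma commute_dist:
  assumes "commute k k'" "\<bar>a - b\<bar> = \<bar>k - k'\<bar>"
  shows "commute a b"
proof -
  consider "a - b = k - k'" | "a - b = k' - k" using assms(2) by linarith
  then show ?thesis
  proof cases
    case 1
    then show ?thesis using commute_shift[OF assms(1), of "a - k"] by (simp add: algebra_simps)
  next
    case 2
    then show ?thesis using commute_shift[OF commute_sym[OF assms(1)], of "a - k'"]
      by (simp add: algebra_simps)
  qed
qed

text \<open>One pair of colors suffices, because the opposite color gives the inverse element and
  inverses of commuting elements commute.\<close>

lemma commuteI:
  assumes "\<And>l m. gl k c l @ gl k' c' m \<approx> gl k' c' m @ gl k c l"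
  shows "commute k k'"
proof -
  have 1: "gl k d l @ gl k' c' m \<approx> gl k' c' m @ gl k d l" for d l m
    using R_commute_inverse[OF assms gl_cancel' gl_cancel] assms by (cases "d = c") (auto simp: neq_opp)
  have "gl k' d' m @ gl k d l \<approx> gl k d l @ gl k' d' m" for d d' l m
    using R_commute_inverse[OF R_sym[OF 1] gl_cancel' gl_cancel] R_sym[OF 1]
    by (cases "d' = c'") (auto simp: neq_opp)
  then show ?thesis unfolding commute_def using R_sym by blast
qed

text \<open>The word is a commutator of two conjugated letters in disguise. The height conditions
  say that each auxiliary stretch leads from the end of one marked step to the start of the next,
  beginning and ending at height 0.\<close>

lemma commute_from_word:
  assumes R: "\<And>l m. w0 @ (c, Some l) # w1 @ (c', Some m) # w2 @ (opp c, Some l) # w3 @ (opp c', Some m) # w4 \<approx> []"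
    and none: "\<And>x. x \<in> set w0 \<union> set w1 \<union> set w2 \<union> set w3 \<union> set w4 \<Longrightarrow> snd x = None"
    and ht: "ht (map fst w0) = lh c k"
      "lh (opp c) k + ht (map fst w1) = lh c' k'"
      "lh (opp c') k' + ht (map fst w2) = lh (opp c) k"
      "lh c k + ht (map fst w3) = lh (opp c') k'"
      "lh c' k' + ht (map fst w4) = 0"
  shows "commute k k'"
proof (rule commuteI)
  fix l m :: 'l
  let ?a = "(c, Some l)" and ?b = "(c', Some m)" and ?a' = "(opp c, Some l)" and ?b' = "(opp c', Some m)"
  have z: "w \<approx> zw h" if "set w \<subseteq> set w0 \<union> set w1 \<union> set w2 \<union> set w3 \<union> set w4" "ht (map fst w) = h" for w h
    using R_zw[of w] none that by blast
  have "gl k c l @ gl k' c' m @ gl k (opp c) l @ gl k' (opp c') m \<approx>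
    zw (lh c k) @ [?a] @ (zw (- lh (opp c) k) @ zw (lh c' k')) @ [?b] @ (zw (- lh (opp c') k') @ zw (lh (opp c) k))
    @ [?a'] @ (zw (- lh c k) @ zw (lh (opp c') k')) @ [?b'] @ zw (- lh c' k')"
    by (simp add: gl_def)
  \<comment> \<open>The two powers that meet between consecutive marked letters add up to the height
    of the stretch lying there, by the conditions \<open>ht\<close>.\<close>
  also have "\<dots> \<approx> w0 @ [?a] @ w1 @ [?b] @ w2 @ [?a'] @ w3 @ [?b'] @ w4"
    using ht by (intro R_append R_refl R_trans[OF R_zw_add] R_sym[OF z]) auto
  also have "\<dots> \<approx> []" using R[of l m] by simp
  finally have "gl k c l @ gl k' c' m @ gl k (opp c) l @ gl k' (opp c') m \<approx> []" .
  then show "gl k c l @ gl k' c' m \<approx> gl k' c' m @ gl k c l"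
    by (rule R_commutator) (rule gl_cancel')+
qed

end

section \<open>The cyclic order and levels\<close>

text \<open>The cyclic order cut open at its starting point, so that arcs become sublists.\<close>

definition pl :: "partition \<Rightarrow> point list" where
  "pl p = map Lo [0..<length (lo p)] @ map Up (rev [0..<length (up p)])"

lemma distinct_pl [simp]: "distinct (pl p)"
  by (auto simp: pl_def distinct_map inj_on_def)

lemma set_pl [simp]: "set (pl p) = points p"
  by (auto simp: pl_def points_def)

lemma npts_pl: "npts p = int (length (pl p))"
  by (simp add: npts_def pl_def)

lemma pos_split:
  assumes "pl p = u @ a # v"
  shows "pos p a = int (length u)"
proof -
  have k: "length u < length (pl p)" "a = pl p ! length u" using assms by auto
  show ?thesis
  proof (cases "length u < length (lo p)")
    case True
    then show ?thesis using k by (simp add: pl_def nth_append)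
  next
    case False
    then show ?thesis using k by (simp add: pl_def nth_append rev_nth)
  qed
qed

lemma mod_shift_neg: "- n \<le> x \<Longrightarrow> x < 0 \<Longrightarrow> x mod n = x + n" for x n :: int
  using mod_add_self2[of x n] mod_pos_pos_trivial[of "x + n" n] by linarith

text \<open>Position differences modulo \<open>npts p\<close> are ranks counted from the start of
  the arc. This removes modular arithmetic from everything that follows: an arc is either an inner
  sublist or the two outer ones together.\<close>

lemma cyc_split:
  assumes pl: "pl p = u @ a # v @ b # w"
  shows "cyc_open p a b = set v" "cyc_open p b a = set w \<union> set u"
    "cyc_half p a b = insert b (set v)" "cyc_half p b a = insert a (set w \<union> set u)"
proof -
  let ?n = "npts p"
  have n: "?n = int (length u) + int (length v) + int (length w) + 2"
    by (simp add: npts_pl pl)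
  have a: "pos p a = int (length u)" and b: "pos p b = int (length u) + 1 + int (length v)"
    using pos_split[of p u a] pos_split[of p "u @ a # v" b] pl by auto
  have cu: "\<exists>i<length u. pos p c = int i" if "c \<in> set u" for c
  proof -
    obtain x y where "u = x @ c # y" using \<open>c \<in> set u\<close> by (meson split_list)
    then show ?thesis using pos_split[of p x c] pl by (intro exI[of _ "length x"]) auto
  qed
  have cv: "\<exists>i<length v. pos p c = int (length u) + 1 + int i" if "c \<in> set v" for c
  proof -
    obtain x y where "v = x @ c # y" using \<open>c \<in> set v\<close> by (meson split_list)
    then show ?thesis using pos_split[of p "u @ a # x" c] pl by (intro exI[of _ "length x"]) auto
  qed
  have cw: "\<exists>i<length w. pos p c = int (length u) + int (length v) + 2 + int i" if "c \<in> set w" for c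
  proof -
    obtain x y where "w = x @ c # y" using \<open>c \<in> set w\<close> by (meson split_list)
    then show ?thesis using pos_split[of p "u @ a # v @ b # x" c] pl by (intro exI[of _ "length x"]) auto
  qed
  have pts: "points p = set u \<union> {a} \<union> set v \<union> {b} \<union> set w"
    using set_pl[of p] pl by auto
  have dis: "distinct (u @ a # v @ b # w)" using distinct_pl[of p] pl by simp
  have ba: "(pos p b - pos p a) mod ?n = 1 + int (length v)"
    unfolding a b n by (subst mod_pos_pos_trivial) auto
  have ab: "(pos p a - pos p b) mod ?n = int (length u) + int (length w) + 1"
    unfolding a b n by (subst mod_shift_neg) auto
  have ua: "1 + int (length v) < (pos p c - pos p a) mod ?n"
    and ub: "0 < (pos p c - pos p b) mod ?n" "(pos p c - pos p b) mod ?n < int (length u) + int (length w) + 1"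
    if c: "c \<in> set u" for c
  proof -
    obtain i where i: "i < length u" "pos p c = int i" using cu[OF c] by blast
    show "1 + int (length v) < (pos p c - pos p a) mod ?n"
      using i unfolding a n by (subst mod_shift_neg) auto
    have "(pos p c - pos p b) mod ?n = int i + int (length w) + 1"
      using i unfolding b n by (subst mod_shift_neg) auto
    then show "0 < (pos p c - pos p b) mod ?n" "(pos p c - pos p b) mod ?n < int (length u) + int (length w) + 1"
      using i by auto
  qed
  have va: "0 < (pos p c - pos p a) mod ?n" "(pos p c - pos p a) mod ?n < 1 + int (length v)"
    and vb: "int (length u) + int (length w) + 1 < (pos p c - pos p b) mod ?n"
    if c: "c \<in> set v" for c
  proof -
    obtain i where i: "i < length v" "pos p c = int (length u) + 1 + int i" using cv[OF c] by blast
    have "(pos p c - pos p a) mod ?n = 1 + int i"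
      using i unfolding a n by (subst mod_pos_pos_trivial) auto
    then show "0 < (pos p c - pos p a) mod ?n" "(pos p c - pos p a) mod ?n < 1 + int (length v)"
      using i by auto
    show "int (length u) + int (length w) + 1 < (pos p c - pos p b) mod ?n"
      using i unfolding b n by (subst mod_shift_neg) auto
  qed
  have wa: "1 + int (length v) < (pos p c - pos p a) mod ?n"
    and wb: "0 < (pos p c - pos p b) mod ?n" "(pos p c - pos p b) mod ?n < int (length u) + int (length w) + 1"
    if c: "c \<in> set w" for c
  proof -
    obtain i where i: "i < length w" "pos p c = int (length u) + int (length v) + 2 + int i"
      using cw[OF c] by blast
    show "1 + int (length v) < (pos p c - pos p a) mod ?n"
      using i unfolding a n by (subst mod_pos_pos_trivial) auto
    have "(pos p c - pos p b) mod ?n = 1 + int i"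
      using i unfolding b n by (subst mod_pos_pos_trivial) auto
    then show "0 < (pos p c - pos p b) mod ?n" "(pos p c - pos p b) mod ?n < int (length u) + int (length w) + 1"
      using i by auto
  qed
  have mem: "c \<in> points p \<longleftrightarrow> c \<in> set u \<or> c = a \<or> c \<in> set v \<or> c = b \<or> c \<in> set w" for c
    using pts by auto
  note facts = ua ub va vb wa wb
  show "cyc_open p a b = set v"
  proof (rule set_eqI)
    fix c
    show "c \<in> cyc_open p a b \<longleftrightarrow> c \<in> set v"
      using facts(1)[of c] facts(4,5)[of c] facts(7)[of c] dis
      by (auto simp: cyc_open_def ba mem)
  qed
  show "cyc_open p b a = set w \<union> set u"
  proof (rule set_eqI)
    fix c
    show "c \<in> cyc_open p b a \<longleftrightarrow> c \<in> set w \<union> set u"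
      using facts(2,3)[of c] facts(6)[of c] facts(8,9)[of c] dis
      by (auto simp: cyc_open_def ab mem)
  qed
  show "cyc_half p a b = insert b (set v)"
  proof (rule set_eqI)
    fix c
    show "c \<in> cyc_half p a b \<longleftrightarrow> c \<in> insert b (set v)"
      using facts(1)[of c] facts(4,5)[of c] facts(7)[of c] dis
      by (auto simp: cyc_half_def ba mem)
  qed
  show "cyc_half p b a = insert a (set w \<union> set u)"
  proof (rule set_eqI)
    fix c
    show "c \<in> cyc_half p b a \<longleftrightarrow> c \<in> insert a (set w \<union> set u)"
      using facts(2,3)[of c] facts(6)[of c] facts(8,9)[of c] dis
      by (auto simp: cyc_half_def ab mem)
  qed
qed

lemma cyc_open_self: "cyc_open p a a = {}"
  by (auto simp: cyc_open_def)

lemma split_two: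
  assumes "a \<in> set xs" "b \<in> set xs" "a \<noteq> b"
  obtains u v w where "xs = u @ a # v @ b # w" | u v w where "xs = u @ b # v @ a # w"
proof -
  obtain x y where xs: "xs = x @ a # y" using assms(1) by (meson split_list)
  then consider "b \<in> set x" | "b \<in> set y" using assms by auto
  then show thesis
  proof cases
    case 1
    then obtain x1 x2 where "x = x1 @ b # x2" by (meson split_list)
    then show thesis using that(2)[of x1 x2 y] xs by simp
  next
    case 2
    then obtain y1 y2 where "y = y1 @ b # y2" by (meson split_list)
    then show thesis using that(1)[of x y1 y2] xs by simp
  qed
qed

lemma subseq_fourE:
  assumes "subseq [a, b, c, d] xs"
  obtains u1 u2 u3 u4 u5 where "xs = u1 @ a # u2 @ b # u3 @ c # u4 @ d # u5"
  using assms by (auto dest!: list_emb_ConsD)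

lemma subseq_fourI:
  assumes "xs = u @ a # v @ b # w" "c \<in> set v"
  shows "d \<in> set w \<Longrightarrow> subseq [a, c, b, d] xs" "d \<in> set u \<Longrightarrow> subseq [d, a, c, b] xs"
proof -
  obtain v1 v2 where v: "v = v1 @ c # v2" using assms(2) by (meson split_list)
  show "subseq [a, c, b, d] xs" if d: "d \<in> set w"
  proof -
    obtain x y where "w = x @ d # y" using d by (meson split_list)
    then show ?thesis using v assms(1) by (simp add: subseq_four)
  qed
  show "subseq [d, a, c, b] xs" if d: "d \<in> set u"
  proof -
    obtain x y where "u = x @ d # y" using d by (meson split_list)
    then show ?thesis using v assms(1) by (simp add: subseq_four)
  qed
qed

text \<open>After cutting the cycle open, two alternating patterns remain, according to which of the
  two blocks is met first.\<close>

lemma crossesE: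
  assumes "crosses p B B'" "B \<subseteq> points p" "B' \<subseteq> points p"
  obtains a b a' b' where "B \<noteq> B'" "a \<in> B" "b \<in> B" "a' \<in> B'" "b' \<in> B'" "subseq [a, a', b, b'] (pl p)"
  | a b a' b' where "B \<noteq> B'" "a \<in> B" "b \<in> B" "a' \<in> B'" "b' \<in> B'" "subseq [a', a, b', b] (pl p)"
proof -
  obtain \<alpha> \<beta> \<gamma> \<delta> where *: "B \<noteq> B'" "\<alpha> \<in> B" "\<beta> \<in> B" "\<gamma> \<in> B'" "\<delta> \<in> B'"
    "\<gamma> \<in> cyc_open p \<alpha> \<beta>" "\<delta> \<in> cyc_open p \<beta> \<alpha>"
    using assms(1) by (auto simp: crosses_def)
  then have ne: "\<alpha> \<noteq> \<beta>" using cyc_open_self by blast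
  have mem: "\<alpha> \<in> set (pl p)" "\<beta> \<in> set (pl p)" using * assms by auto
  show thesis
  proof (rule split_two[OF mem ne])
    fix u v w
    assume pl: "pl p = u @ \<alpha> # v @ \<beta> # w"
    then have "\<gamma> \<in> set v" "\<delta> \<in> set w \<or> \<delta> \<in> set u" using * cyc_split[OF pl] by auto
    then show thesis using subseq_fourI[OF pl] * that by blast
  next
    fix u v w
    assume pl: "pl p = u @ \<beta> # v @ \<alpha> # w"
    then have "\<delta> \<in> set v" "\<gamma> \<in> set w \<or> \<gamma> \<in> set u" using * cyc_split[OF pl] by auto
    then show thesis using subseq_fourI[OF pl] * that by blast
  qed
qed

lemma crossesI:
  assumes "B \<noteq> B'" "a \<in> B" "b \<in> B" "a' \<in> B'" "b' \<in> B'" "subseq [a, a', b, b'] (pl p)"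
  shows "crosses p B B'" "crosses p B' B"
proof -
  obtain u1 u2 u3 u4 u5 where pl: "pl p = u1 @ a # u2 @ a' # u3 @ b # u4 @ b' # u5"
    using subseq_fourE[OF assms(6)] by metis
  have 1: "a' \<in> cyc_open p a b" "b' \<in> cyc_open p b a"
    using cyc_split[of p u1 a "u2 @ a' # u3" b "u4 @ b' # u5"] pl by auto
  have 2: "b \<in> cyc_open p a' b'" "a \<in> cyc_open p b' a'"
    using cyc_split[of p "u1 @ a # u2" a' "u3 @ b # u4" b' "u5"] pl by auto
  show "crosses p B B'" unfolding crosses_def using 1 assms by blast
  show "crosses p B' B" unfolding crosses_def using 2 assms by blast
qed

lemma sigma_set: "distinct xs \<Longrightarrow> sigma p (set xs) = ht (map (ncol p) xs)"
proof -
  have "(if c = W then 1 else - 1) = sg c" for c by (cases c) auto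
  then show "distinct xs \<Longrightarrow> sigma p (set xs) = ht (map (ncol p) xs)"
    by (simp add: sigma_def sum_list_distinct_conv_sum_set o_def)
qed

text \<open>A point is a step of the walk through the colors; its level is the edge of \<open>\<int>\<close> it traverses,
  named by the lower end.\<close>

definition lev :: "partition \<Rightarrow> point \<Rightarrow> int" where
  "lev p P = ht (map (ncol p) (takeWhile (\<lambda>Q. Q \<noteq> P) (pl p))) - (if ncol p P = W then 0 else 1)"

lemma lev_split:
  assumes "pl p = u @ P # v"
  shows "ht (map (ncol p) u) = lh (ncol p P) (lev p P)"
proof -
  have "P \<notin> set u" using assms distinct_pl[of p] by auto
  then have "takeWhile (\<lambda>Q. Q \<noteq> P) (pl p) = u" unfolding assms by (subst takeWhile_append2) auto
  then show ?thesis by (cases "ncol p P") (auto simp: lev_def)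
qed

lemma S0_wf: "p \<in> S0 \<Longrightarrow> wf_part p"
  by (simp add: S0_def pair_nb_def)

lemma S0_block:
  assumes "p \<in> S0" "B \<in> blks p" "a \<in> B"
  obtains b where "B = {a, b}" "b \<noteq> a" "ncol p b = opp (ncol p a)"
proof -
  obtain \<alpha> \<beta> where "B = {\<alpha>, \<beta>}" "ncol p \<alpha> \<noteq> ncol p \<beta>"
    using assms(1,2) by (auto simp: S0_def pair_nb_def)
  with assms(3) consider "a = \<alpha>" "B = {a, \<beta>}" "ncol p \<beta> = opp (ncol p a)"
    | "a = \<beta>" "B = {a, \<alpha>}" "ncol p \<alpha> = opp (ncol p a)"
    using neq_opp by (metis insert_commute insert_iff singletonD)
  then show thesis by cases (use that opp_neq in metis)+
qed

lemma S0_other: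
  assumes "p \<in> S0" "B \<in> blks p" "a \<in> B" "b \<in> B" "a \<noteq> b"
  shows "B = {a, b}" "ncol p b = opp (ncol p a)"
proof -
  obtain c where "B = {a, c}" "ncol p c = opp (ncol p a)" by (rule S0_block[OF assms(1-3)])
  moreover from this have "b = c" using assms(4,5) by auto
  ultimately show "B = {a, b}" "ncol p b = opp (ncol p a)" by simp_all
qed

lemma S0_between:
  assumes "p \<in> S0" "B \<in> blks p" "a \<in> B" "b \<in> B" "pl p = u @ a # v @ b # w"
  shows "ht (map (ncol p) v) = 0" "ht (map (ncol p) u) + ht (map (ncol p) w) = 0"
    "ncol p b = opp (ncol p a)"
proof -
  have d: "distinct (u @ a # v @ b # w)" using distinct_pl[of p] assms(5) by simp
  then have "a \<noteq> b" by auto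
  then have z: "sigma p (cyc_open p a b) = 0" "sigma p (cyc_open p b a) = 0"
    using assms(1-4) by (auto simp: S0_def)
  show "ht (map (ncol p) v) = 0"
    using z(1) cyc_split(1)[OF assms(5)] sigma_set[of v p] d by simp
  show "ht (map (ncol p) u) + ht (map (ncol p) w) = 0"
    using z(2) cyc_split(2)[OF assms(5)] sigma_set[of "u @ w" p] d by (auto simp: Un_commute)
  show "ncol p b = opp (ncol p a)" using S0_other assms \<open>a \<noteq> b\<close> by blast
qed

lemma wf_part_block:
  assumes "wf_part p" "P \<in> points p"
  obtains B where "B \<in> blks p" "P \<in> B"
proof -
  have "P \<in> \<Union> (blks p)" using assms by (simp add: wf_part_def)
  then show thesis using that by blast
qed

text \<open>Any one block shows it: both of its arcs have height 0 and its two points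
  cancel.\<close>

lemma S0_total:
  assumes "p \<in> S0"
  shows "ht (map (ncol p) (pl p)) = 0"
proof (cases "points p = {}")
  case True
  then have "pl p = []" using set_pl[of p] by (metis set_empty)
  then show ?thesis by simp
next
  case False
  then obtain B a where B: "B \<in> blks p" "a \<in> B"
    using wf_part_block[OF S0_wf[OF assms]] by blast
  obtain b where b: "B = {a, b}" "b \<noteq> a" by (rule S0_block[OF assms B])
  have pts: "a \<in> set (pl p)" "b \<in> set (pl p)" using wf_partD(1)[OF S0_wf[OF assms] B(1)] b by auto
  show ?thesis
  proof (rule split_two[OF pts])
    fix u v w assume pl: "pl p = u @ a # v @ b # w"
    show ?thesis using S0_between[OF assms B(1) _ _ pl] b(1) by (simp add: pl)
  next
    fix u v w assume pl: "pl p = u @ b # v @ a # w"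
    show ?thesis using S0_between[OF assms B(1) _ _ pl] b(1) by (simp add: pl)
  qed (use b in auto)
qed

lemma lh_inj [simp]: "lh c k = lh c k' \<longleftrightarrow> k = k'"
  by (cases c) auto

text \<open>The arc between the two points has height 0, so the second step starts where the first
  one ended. Having the opposite color, it runs back along the same edge.\<close>

lemma S0_lev:
  assumes "p \<in> S0" "B \<in> blks p" "a \<in> B" "b \<in> B"
  shows "lev p a = lev p b"
proof -
  have *: "lev p x = lev p y" if x: "x \<in> B" "y \<in> B" "pl p = u @ x # v @ y # w" for x y u v w
  proof -
    have "lh (ncol p y) (lev p y) = lh (ncol p x) (lev p x) + sg (ncol p x)"
      using lev_split[of p u x] lev_split[of p "u @ x # v" y w] x(3)
        S0_between(1)[OF assms(1,2) x] by simp
    then show ?thesis using S0_between(3)[OF assms(1,2) x] by (simp add: lh_opp)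
  qed
  show ?thesis
  proof (cases "a = b")
    case False
    have "a \<in> set (pl p)" "b \<in> set (pl p)" using wf_partD(1)[OF S0_wf[OF assms(1)] assms(2)] assms by auto
    then show ?thesis
    proof (rule split_two[OF _ _ False])
      fix u v w assume "pl p = u @ a # v @ b # w"
      then show ?thesis using * assms(3,4) by blast
    next
      fix u v w assume "pl p = u @ b # v @ a # w"
      then show ?thesis using *[OF assms(4,3)] by simp
    qed
  qed simp
qed

text \<open>The case distinction in \<open>delta\<close> is what converts a difference of heights
  into a difference of edges: between equal colors, the walk along the open arc misses the level
  difference by exactly one step. An arc that passes the cut is reduced to the complementary one by
  the total height 0.\<close>

lemma delta_lev:
  assumes "p \<in> S0" "a \<in> points p" "b \<in> points p" "a \<noteq> b"
  shows "delta p a b = lev p b - lev p a"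
proof -
  have mem: "a \<in> set (pl p)" "b \<in> set (pl p)" using assms by auto
  have neq: "ncol p a \<noteq> ncol p b \<longleftrightarrow> ncol p b = opp (ncol p a)" by (rule neq_opp)
  note tot = S0_total[OF assms(1)]
  show ?thesis
  proof (rule split_two[OF mem assms(4)])
    fix u v w assume pl: "pl p = u @ a # v @ b # w"
    have d: "distinct (v @ [b])" using distinct_pl[of p] pl by simp
    have "sigma p (cyc_open p a b) = ht (map (ncol p) v)"
      "sigma p (cyc_half p a b) = ht (map (ncol p) v) + sg (ncol p b)"
      using cyc_split[OF pl] sigma_set[of v p] sigma_set[OF d, of p] d by auto
    moreover have "lh (ncol p b) (lev p b) = lh (ncol p a) (lev p a) + sg (ncol p a) + ht (map (ncol p) v)"
      using lev_split[of p u a] lev_split[of p "u @ a # v" b w] pl by simp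
    ultimately show ?thesis
      by (cases "ncol p a"; cases "ncol p b") (auto simp: delta_def)
  next
    fix u v w assume pl: "pl p = u @ b # v @ a # w"
    have d: "distinct (b # w @ u)" using distinct_pl[of p] pl by auto
    have "sigma p (cyc_open p a b) = ht (map (ncol p) w) + ht (map (ncol p) u)"
      "sigma p (cyc_half p a b) = ht (map (ncol p) w) + ht (map (ncol p) u) + sg (ncol p b)"
      using cyc_split[OF pl] sigma_set[of "w @ u" p] sigma_set[OF d, of p] d by auto
    moreover have "lh (ncol p a) (lev p a) = lh (ncol p b) (lev p b) + sg (ncol p b) + ht (map (ncol p) v)"
      using lev_split[of p u b] lev_split[of p "u @ b # v" a w] pl by simp
    moreover have "ht (map (ncol p) u) + sg (ncol p b) + ht (map (ncol p) v) + sg (ncol p a) + ht (map (ncol p) w) = 0"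
      using tot by (simp add: pl)
    ultimately show ?thesis
      by (cases "ncol p a"; cases "ncol p b") (auto simp: delta_def)
  qed
qed

definition Lev :: "partition \<Rightarrow> point set \<Rightarrow> int" where
  "Lev p B = lev p (SOME a. a \<in> B)"

lemma Lev_eq: "p \<in> S0 \<Longrightarrow> B \<in> blks p \<Longrightarrow> a \<in> B \<Longrightarrow> lev p a = Lev p B"
  unfolding Lev_def by (rule S0_lev[of _ B]) (auto intro: someI[of "\<lambda>a. a \<in> B"])

lemma dist_Lev:
  assumes p: "p \<in> S0" and B: "B \<in> blks p" "B' \<in> blks p" "B \<noteq> B'"
  shows "dist p B B' = nat \<bar>Lev p B - Lev p B'\<bar>"
proof -
  let ?a = "SOME a. a \<in> B" and ?b = "SOME a. a \<in> B'"
  have m: "?a \<in> B" "?b \<in> B'" using wf_partD(2)[OF S0_wf[OF p]] B by (auto simp: some_in_eq)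
  then have "?a \<noteq> ?b" using wf_part_eq[OF S0_wf[OF p] B(1,2)] B(3) by metis
  moreover have "?a \<in> points p" "?b \<in> points p" using m wf_partD(1)[OF S0_wf[OF p]] B by auto
  ultimately have "delta p ?a ?b = Lev p B' - Lev p B"
    using delta_lev[OF p] by (simp add: Lev_def)
  then show ?thesis by (simp add: dist_def abs_minus_commute)
qed

text \<open>Rotating the upper row to the right end of the lower one reverses it and turns its
  colors into normalized colors, which is the inverse of its word. Hence the rows are congruent
  exactly if the cyclic word is trivial.\<close>

lemma labelled_pl: "map (\<lambda>P. (ncol p P, \<phi> P)) (pl p) = low p \<phi> @ winv (upw p \<phi>)"
  by (simp add: pl_def low_def upw_def winv_def rev_map o_def)

section \<open>Categories and commuting levels\<close>

lemma height_words_hom: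
  assumes "category C"
  shows "height_words (hom C :: (color \<times> 'l option) list \<Rightarrow> _)"
proof
  fix c :: color and l :: "'l option"
  show "hom C [(c, l), (opp c, l)] []" by (rule hom_sym[OF assms hom_pairp[OF assms]])
qed (use assms hom_refl hom_sym hom_trans hom_append in blast)+

text \<open>Label \<open>A\<close> and \<open>B\<close> freely and all other blocks by
  \<open>None\<close>. The cyclic word of \<open>q\<close> is then trivial and has two alternating
  marked pairs; its stretches have the required heights because both points of a block have the same
  level.\<close>

lemma commute_crossing_subseq:
  assumes C: "category C" and q: "q \<in> C" "q \<in> S0"
    and A: "A \<in> blks q" "a \<in> A" "b \<in> A" and B: "B \<in> blks q" "a' \<in> B" "b' \<in> B" and "A \<noteq> B"
    and sub: "subseq [a, a', b, b'] (pl q)"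
  shows "height_words.commute (hom C :: (color \<times> 'l option) list \<Rightarrow> _) (Lev q A) (Lev q B)"
proof -
  interpret height_words "hom C :: (color \<times> 'l option) list \<Rightarrow> _"
    by (rule height_words_hom[OF C])
  obtain u0 u1 u2 u3 u4 where pl: "pl q = u0 @ a # u1 @ a' # u2 @ b # u3 @ b' # u4"
    using subseq_fourE[OF sub] by metis
  have d: "distinct (u0 @ a # u1 @ a' # u2 @ b # u3 @ b' # u4)" using distinct_pl[of q] pl by simp
  have ab: "a \<noteq> b" "a' \<noteq> b'" using d by auto
  note Ab = S0_other[OF q(2) A ab(1)] and Bb = S0_other[OF q(2) B ab(2)]
  have disj: "a' \<notin> A" "b' \<notin> A" using d Ab by auto
  define n where "n = map (\<lambda>P. (ncol q P, None :: 'l option))"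
  show ?thesis
  proof (rule commute_from_word[of "n u0" "ncol q a" "n u1" "ncol q a'" "n u2" "n u3" "n u4"])
    fix l m :: 'l
    define \<phi> where "\<phi> P = (if P \<in> A then Some l else if P \<in> B then Some m else None)" for P
    have "block_const q \<phi>"
      unfolding block_const_def
    proof (intro ballI)
      fix E P Q assume E: "E \<in> blks q" "P \<in> E" "Q \<in> E"
      then have "P \<in> A \<longleftrightarrow> Q \<in> A" "P \<in> B \<longleftrightarrow> Q \<in> B"
        using wf_part_eq[OF S0_wf[OF q(2)]] A(1) B(1) by metis+
      then show "\<phi> P = \<phi> Q" by (simp add: \<phi>_def)
    qed
    then have "hom C (upw q \<phi>) (low q \<phi>)" using q(1) unfolding hom_def by blast
    then have "hom C (low q \<phi> @ winv (upw q \<phi>)) []" by (rule R_to_trivial[OF R_sym])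
    then have "hom C (map (\<lambda>P. (ncol q P, \<phi> P)) (pl q)) []" by (simp only: labelled_pl)
    moreover have "map (\<lambda>P. (ncol q P, \<phi> P)) u = n u"
      if "set u \<subseteq> set u0 \<union> set u1 \<union> set u2 \<union> set u3 \<union> set u4" for u
      unfolding n_def
    proof (rule map_cong[OF refl])
      fix x assume "x \<in> set u"
      then have "x \<notin> A" "x \<notin> B" using that d Ab(1) Bb(1) by auto
      then show "(ncol q x, \<phi> x) = (ncol q x, None)" by (simp add: \<phi>_def)
    qed
    moreover have "\<phi> a = Some l" "\<phi> b = Some l" "\<phi> a' = Some m" "\<phi> b' = Some m"
      using A B disj by (auto simp: \<phi>_def)
    ultimately show "hom C (n u0 @ (ncol q a, Some l) # n u1 @ (ncol q a', Some m) # n u2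
        @ (opp (ncol q a), Some l) # n u3 @ (opp (ncol q a'), Some m) # n u4) []"
      by (simp add: pl Ab(2) Bb(2) subset_iff)
  next
    show "snd x = None" if "x \<in> set (n u0) \<union> set (n u1) \<union> set (n u2) \<union> set (n u3) \<union> set (n u4)" for x
      using that by (auto simp: n_def)
  next
    have hn: "map fst (n u) = map (ncol q) u" for u by (simp add: n_def o_def)
    have L: "lev q a = Lev q A" "lev q b = Lev q A" "lev q a' = Lev q B" "lev q b' = Lev q B"
      using Lev_eq[OF q(2)] A B by auto
    note h = lev_split[of q u0 a] lev_split[of q "u0 @ a # u1" a'] lev_split[of q "u0 @ a # u1 @ a' # u2" b]
      lev_split[of q "u0 @ a # u1 @ a' # u2 @ b # u3" b'] S0_total[OF q(2)]
    show "ht (map fst (n u0)) = lh (ncol q a) (Lev q A)"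
      "lh (opp (ncol q a)) (Lev q A) + ht (map fst (n u1)) = lh (ncol q a') (Lev q B)"
      "lh (opp (ncol q a')) (Lev q B) + ht (map fst (n u2)) = lh (opp (ncol q a)) (Lev q A)"
      "lh (ncol q a) (Lev q A) + ht (map fst (n u3)) = lh (opp (ncol q a')) (Lev q B)"
      "lh (ncol q a') (Lev q B) + ht (map fst (n u4)) = 0"
      using h by (simp_all add: pl hn L Ab(2) Bb(2) lh_opp)
  qed
qed

lemma commute_crossing:
  assumes C: "category C" and q: "q \<in> C" "q \<in> S0"
    and A: "A \<in> blks q" and B: "B \<in> blks q" and cr: "crosses q A B"
  shows "height_words.commute (hom C :: (color \<times> 'l option) list \<Rightarrow> _) (Lev q A) (Lev q B)"
proof -
  interpret height_words "hom C :: (color \<times> 'l option) list \<Rightarrow> _"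
    by (rule height_words_hom[OF C])
  show ?thesis
  proof (rule crossesE[OF cr wf_partD(1)[OF S0_wf[OF q(2)] A] wf_partD(1)[OF S0_wf[OF q(2)] B]])
    fix a b a' b'
    assume *: "A \<noteq> B" "a \<in> A" "b \<in> A" "a' \<in> B" "b' \<in> B"
    show ?thesis if "subseq [a, a', b, b'] (pl q)"
      using commute_crossing_subseq[OF C q A *(2,3) B *(4,5,1) that] .
    show ?thesis if "subseq [a', a, b', b] (pl q)"
      using commute_sym[OF commute_crossing_subseq[OF C q B *(4,5) A *(2,3) *(1)[symmetric] that]] .
  qed
qed

section \<open>Membership of a partition whose crossing levels commute\<close>

definition bl :: "partition \<Rightarrow> point \<Rightarrow> point set" where
  "bl p P = (THE B. B \<in> blks p \<and> P \<in> B)"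

lemma bl_eq: "wf_part p \<Longrightarrow> B \<in> blks p \<Longrightarrow> P \<in> B \<Longrightarrow> bl p P = B"
  unfolding bl_def by (rule the_equality, simp) (metis wf_part_eq)

lemma bl_in: "wf_part p \<Longrightarrow> P \<in> points p \<Longrightarrow> bl p P \<in> blks p \<and> P \<in> bl p P"
  by (rule wf_part_block[of p P]) (auto simp: bl_eq)

text \<open>A two-point block contained in a two-point block equals it, and the blocks of both
  partitions cover the same points.\<close>

lemma S0_eq_bl:
  assumes e: "e \<in> S0" and p: "p \<in> S0" and ul: "up e = up p" "lo e = lo p"
    and bl: "\<And>B P Q. B \<in> blks e \<Longrightarrow> P \<in> B \<Longrightarrow> Q \<in> B \<Longrightarrow> bl p P = bl p Q"
  shows "e = p"
proof -
  note we = S0_wf[OF e] and wp = S0_wf[OF p]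
  have pts: "points e = points p" by (simp add: points_def ul)
  have eq: "B = bl p P" if B: "B \<in> blks e" "P \<in> B" for B P
  proof -
    obtain Q where Q: "B = {P, Q}" "Q \<noteq> P" by (rule S0_block[OF e B])
    have "P \<in> points p" "Q \<in> points p" using wf_partD(1)[OF we B(1)] Q pts by auto
    then have "bl p P \<in> blks p" "P \<in> bl p P" "Q \<in> bl p P"
      using bl_in[OF wp] bl[OF B(1), of P Q] Q by auto
    then show ?thesis using S0_other(1)[OF p, of "bl p P" P Q] Q by auto
  qed
  have "blks e = blks p"
  proof
    show "blks e \<subseteq> blks p"
    proof
      fix B assume B: "B \<in> blks e"
      then obtain P where P: "P \<in> B" using wf_partD(2)[OF we] by blast
      then have "P \<in> points p" using wf_partD(1)[OF we B] pts by auto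
      then show "B \<in> blks p" using eq[OF B P] bl_in[OF wp] by simp
    qed
    show "blks p \<subseteq> blks e"
    proof
      fix B assume B: "B \<in> blks p"
      then obtain P where P: "P \<in> B" using wf_partD(2)[OF wp] by blast
      then have "P \<in> points e" using wf_partD(1)[OF wp B] pts by auto
      then obtain E where E: "E \<in> blks e" "P \<in> E" using wf_part_block[OF we] by blast
      then show "B \<in> blks e" using eq[OF E] bl_eq[OF wp B P] by simp
    qed
  qed
  then show ?thesis using ul by simp
qed

lemma map_eq_split:
  assumes "map f xs = w @ y # r"
  obtains u x v where "xs = u @ x # v" "f x = y" "map f v = r"
  using assms by (force simp: map_eq_append_conv Cons_eq_map_conv)

text \<open>The blocks themselves serve as labels, so that a relation between the labelled rows
  remembers \<open>p\<close>. Chords of the rewritten word are blocks and crossing chords are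
  crossing blocks.\<close>

lemma mem_from_commute:
  assumes C: "category C" "C \<subseteq> S0" and p: "p \<in> S0"
    and comm: "\<And>B B'. B \<in> blks p \<Longrightarrow> B' \<in> blks p \<Longrightarrow> crosses p B B' \<Longrightarrow>
      height_words.commute (hom C :: (color \<times> point set option) list \<Rightarrow> _) (Lev p B) (Lev p B')"
  shows "p \<in> C"
proof -
  interpret height_words "hom C :: (color \<times> point set option) list \<Rightarrow> _"
    by (rule height_words_hom[OF C(1)])
  note wp = S0_wf[OF p]
  define \<phi> where "\<phi> P = Some (bl p P)" for P
  define x where "x P = (ncol p P, bl p P)" for P
  define G where "G = (\<lambda>(c, B). gl (Lev p B) c B)"
  have bl: "bl p P \<in> blks p" "P \<in> bl p P" if "P \<in> points p" for P
    using bl_in[OF wp that] by auto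
  have levbl: "lev p P = Lev p (bl p P)" if "P \<in> points p" for P
    using Lev_eq[OF p] bl[OF that] by blast
  \<comment> \<open>The power in front records the height reached so far. After each letter,
    \<open>z ^ (-h)\<close> and \<open>z ^ h\<close> are inserted for the new height
    \<open>h\<close>; this splits off one factor \<open>G\<close> and leaves the same situation for
    the remaining points.\<close>
  have tele: "hom C (zw (ht (map (ncol p) u)) @ map (\<lambda>P. (ncol p P, \<phi> P)) v)
      (concat (map G (map x v)) @ zw (ht (map (ncol p) (pl p))))" if "pl p = u @ v" for u v
    using that
  proof (induction v arbitrary: u)
    case (Cons P v)
    let ?c = "ncol p P" and ?k = "lev p P"
    have "P \<in> points p" using set_pl[of p] Cons.prems by auto
    then have G: "G (x P) = zw (lh ?c ?k) @ [(?c, \<phi> P)] @ zw (- lh (opp ?c) ?k)"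
      by (simp add: G_def x_def gl_def levbl \<phi>_def)
    have u: "ht (map (ncol p) u) = lh ?c ?k" by (rule lev_split[OF Cons.prems])
    then have u': "ht (map (ncol p) (u @ [P])) = lh (opp ?c) ?k" by (simp add: lh_opp)
    have "hom C (zw (lh ?c ?k) @ (?c, \<phi> P) # map (\<lambda>P. (ncol p P, \<phi> P)) v)
       (G (x P) @ zw (lh (opp ?c) ?k) @ map (\<lambda>P. (ncol p P, \<phi> P)) v)"
      using R_sym[OF R_zw_delete[of "- lh (opp ?c) ?k" "lh (opp ?c) ?k" "zw (lh ?c ?k) @ [(?c, \<phi> P)]"
            "map (\<lambda>P. (ncol p P, \<phi> P)) v"]]
      by (simp add: G)
    also have "hom C \<dots> (G (x P) @ concat (map G (map x v)) @ zw (ht (map (ncol p) (pl p))))"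
      using R_append[OF R_refl[of "G (x P)"] Cons.IH[of "u @ [P]", unfolded u']] Cons.prems by simp
    finally show ?case unfolding u by simp
  qed simp
  have "hom C (concat (map G (map x (pl p)))) []"
  proof (rule R_chords)
    show "hom C (G (c, i) @ G (opp c, i)) []" for c i
      by (simp add: G_def gl_cancel)
    \<comment> \<open>Block and color determine a point, since the two points of a block have
      opposite colors.\<close>
    have inj: "P = Q" if "P \<in> points p" "Q \<in> points p" "x P = x Q" for P Q
    proof (rule ccontr)
      assume "P \<noteq> Q"
      then have "ncol p Q = opp (ncol p P)"
        using S0_other(2)[OF p, of "bl p P" P Q] bl[OF that(1)] bl[OF that(2)] that(3)
        by (auto simp: x_def)
      then show False using that(3) by (simp add: x_def)
    qed
    then show "distinct (map x (pl p))" by (auto simp: distinct_map inj_on_def)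
    show "(opp c, i) \<in> set (map x (pl p))" if i: "(c, i) \<in> set (map x (pl p))" for c i
    proof -
      obtain P where P: "P \<in> points p" "c = ncol p P" "i = bl p P" using i by (auto simp: x_def)
      obtain Q where Q: "bl p P = {P, Q}" "ncol p Q = opp (ncol p P)"
        by (rule S0_block[OF p bl[OF P(1)]])
      have "bl p Q = bl p P" by (rule bl_eq[OF wp]) (use bl[OF P(1)] Q in auto)
      moreover have "Q \<in> points p" using wf_partD(1)[OF wp] bl[OF P(1)] Q by auto
      ultimately have "x Q = (opp c, i)" using P Q by (simp add: x_def)
      then show ?thesis using \<open>Q \<in> points p\<close> by force
    qed
    show "\<forall>d d'. hom C (G (d, i) @ G (d', j)) (G (d', j) @ G (d, i))"
      if ij: "i \<noteq> j" and s: "subseq [(c, i), (c', j), (opp c, i), (opp c', j)] (map x (pl p))" for c c' i j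
    proof -
      obtain w1 w2 w3 w4 w5 where
        "map x (pl p) = w1 @ (c, i) # w2 @ (c', j) # w3 @ (opp c, i) # w4 @ (opp c', j) # w5"
        using subseq_fourE[OF s] by metis
      then obtain u1 a v1 where 1: "pl p = u1 @ a # v1" "x a = (c, i)"
        and m1: "map x v1 = w2 @ (c', j) # w3 @ (opp c, i) # w4 @ (opp c', j) # w5"
        by (rule map_eq_split)
      from m1 obtain u2 a' v2 where 2: "v1 = u2 @ a' # v2" "x a' = (c', j)"
        and m2: "map x v2 = w3 @ (opp c, i) # w4 @ (opp c', j) # w5"
        by (rule map_eq_split)
      from m2 obtain u3 b v3 where 3: "v2 = u3 @ b # v3" "x b = (opp c, i)"
        and m3: "map x v3 = w4 @ (opp c', j) # w5"
        by (rule map_eq_split)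
      from m3 obtain u4 b' u5 where 4: "v3 = u4 @ b' # u5" "x b' = (opp c', j)"
        by (rule map_eq_split)
      have pl: "pl p = u1 @ a # u2 @ a' # u3 @ b # u4 @ b' # u5" using 1(1) 2(1) 3(1) 4(1) by simp
      note lab = 1(2) 2(2) 3(2) 4(2)
      have pts: "a \<in> points p" "a' \<in> points p" "b \<in> points p" "b' \<in> points p"
        using set_pl[of p] unfolding pl by auto
      then have mem: "a \<in> i" "b \<in> i" "a' \<in> j" "b' \<in> j" "i \<in> blks p" "j \<in> blks p"
        using bl lab unfolding x_def by auto
      have "subseq [a, a', b, b'] (pl p)" by (simp add: pl subseq_four)
      then have "crosses p i j" using ij mem by (intro crossesI(1))
      then have "commute (Lev p i) (Lev p j)" using comm mem by blast
      then show ?thesis by (simp add: commute_def G_def)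
    qed
  qed
  moreover have "hom C (map (\<lambda>P. (ncol p P, \<phi> P)) (pl p)) (concat (map G (map x (pl p))))"
    using tele[of "[]" "pl p"] S0_total[OF p] by simp
  ultimately have "hom C (low p \<phi> @ winv (upw p \<phi>)) []" using R_trans unfolding labelled_pl by blast
  then have "hom C (upw p \<phi>) (low p \<phi>)" by (rule R_sym[OF R_from_trivial])
  \<comment> \<open>The witness \<open>e\<close> is a priori another partition with the rows of
    \<open>p\<close>. Its labels are constant on blocks, so each of its blocks lies in a block of
    \<open>p\<close>.\<close>
  then obtain e \<chi> where e: "e \<in> C" "block_const e \<chi>" "upw p \<phi> = upw e \<chi>" "low p \<phi> = low e \<chi>"
    unfolding hom_def by blast
  have ul: "up e = up p" "lo e = lo p" using e(3,4) map_fst_upw map_fst_low by metis+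
  have \<chi>: "\<chi> P = Some (bl p P)" if "P \<in> points e" for P
  proof (cases P)
    case (Up i)
    then have "i < length (up p)" using that ul by (auto simp: points_def)
    then show ?thesis using Up e(3) ul nth_upw[of i p \<phi>] nth_upw[of i e \<chi>] by (simp add: \<phi>_def)
  next
    case (Lo i)
    then have "i < length (lo p)" using that ul by (auto simp: points_def)
    then show ?thesis using Lo e(4) ul nth_low[of i p \<phi>] nth_low[of i e \<chi>] by (simp add: \<phi>_def)
  qed
  have "e \<in> S0" using e(1) C(2) by auto
  then have "e = p"
  proof (rule S0_eq_bl[OF _ p ul])
    fix B P Q assume B: "B \<in> blks e" "P \<in> B" "Q \<in> B"
    then have "P \<in> points e" "Q \<in> points e" using wf_partD(1)[OF S0_wf[OF \<open>e \<in> S0\<close>]] by auto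
    then show "bl p P = bl p Q" using \<chi> block_constD[OF e(2) B] by simp
  qed
  then show ?thesis using e(1) by simp
qed

section \<open>Crossings at intermediate levels\<close>

text \<open>The edge \<open>i\<close> joins the heights \<open>i\<close> and \<open>i + 1\<close>.
  Signed traversals of it telescope to the change of the indicator of being above it.\<close>

lemma level_count:
  assumes "pl p = u @ v @ w"
  shows "sum_list (map (\<lambda>P. if lev p P = i then sg (ncol p P) else 0) v)
    = of_bool (i < ht (map (ncol p) (u @ v))) - of_bool (i < ht (map (ncol p) u))"
  using assms
proof (induction v arbitrary: u)
  case (Cons P v)
  have "ht (map (ncol p) u) = lh (ncol p P) (lev p P)" using lev_split Cons.prems by simp
  then have "(if lev p P = i then sg (ncol p P) else 0)
    = of_bool (i < ht (map (ncol p) (u @ [P]))) - of_bool (i < ht (map (ncol p) u))"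
    by (cases "ncol p P") auto
  then show ?case using Cons.IH[of "u @ [P]"] Cons.prems by simp
qed simp

text \<open>Between a point of \<open>A\<close> and a point of \<open>B\<close> the walk traverses the edge \<open>i\<close> a nonzero number of
  times, counted with sign, so some block of level \<open>i\<close> leaves the arc between them.\<close>

lemma intermediate_crossing:
  assumes p: "p \<in> S0" and A: "A \<in> blks p" "a \<in> A" "a' \<in> A" and B: "B \<in> blks p" "b \<in> B" "b' \<in> B"
    and sub: "subseq [a, b, a', b'] (pl p)"
    and i: "Lev p A < i \<and> i < Lev p B \<or> Lev p B < i \<and> i < Lev p A"
  obtains E where "E \<in> blks p" "Lev p E = i" "crosses p A E \<or> crosses p B E"
proof -
  note wp = S0_wf[OF p]
  obtain u1 u2 u3 u4 u5 where pl: "pl p = u1 @ a # u2 @ b # u3 @ a' # u4 @ b' # u5"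
    using subseq_fourE[OF sub] by metis
  have L: "lev p a = Lev p A" "lev p a' = Lev p A" "lev p b = Lev p B" "lev p b' = Lev p B"
    using Lev_eq[OF p] A B by auto
  define S where "S = {P \<in> set u2. lev p P = i}"
  have pts: "P \<in> points p" if "P \<in> S" for P
    using that set_pl[of p] unfolding pl S_def by auto
  have "(\<Sum>P\<in>S. sg (ncol p P)) = sum_list (map (\<lambda>P. if lev p P = i then sg (ncol p P) else 0) u2)"
  proof -
    have "distinct u2" using distinct_pl[of p] unfolding pl by simp
    then show ?thesis
      by (simp add: S_def sum_list_distinct_conv_sum_set sum.inter_filter)
  qed
  also have "\<dots> = of_bool (i < ht (map (ncol p) (u1 @ a # u2))) - of_bool (i < ht (map (ncol p) (u1 @ [a])))"
    using level_count[of p "u1 @ [a]" u2] pl by simp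
  \<comment> \<open>Since \<open>i\<close> lies strictly between the two levels, the walk is on one
    side of the edge \<open>i\<close> after \<open>a\<close> and on the other side before
    \<open>b\<close>, whatever the colors.\<close>
  also have "\<dots> \<noteq> 0"
  proof -
    have "ht (map (ncol p) (u1 @ a # u2)) = lh (ncol p b) (Lev p B)"
      using lev_split[of p "u1 @ a # u2" b] pl L by simp
    moreover have "ht (map (ncol p) (u1 @ [a])) = lh (opp (ncol p a)) (Lev p A)"
      using lev_split[of p u1 a] pl L by (simp add: lh_opp)
    ultimately show ?thesis using i by (cases "ncol p a"; cases "ncol p b") auto
  qed
  finally have nz: "(\<Sum>P\<in>S. sg (ncol p P)) \<noteq> 0" .
  define m where "m P = (SOME Q. bl p P = {P, Q} \<and> Q \<noteq> P \<and> ncol p Q = opp (ncol p P))" for P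
  have m: "bl p P = {P, m P}" "m P \<noteq> P" "ncol p (m P) = opp (ncol p P)" if "P \<in> points p" for P
  proof -
    have "\<exists>Q. bl p P = {P, Q} \<and> Q \<noteq> P \<and> ncol p Q = opp (ncol p P)"
      by (rule S0_block[OF p, of "bl p P" P]) (use bl_in[OF wp that] in auto)
    then have "bl p P = {P, m P} \<and> m P \<noteq> P \<and> ncol p (m P) = opp (ncol p P)"
      unfolding m_def by (rule someI_ex)
    then show "bl p P = {P, m P}" "m P \<noteq> P" "ncol p (m P) = opp (ncol p P)" by auto
  qed
  have mm: "m P \<in> points p" "m (m P) = P" if "P \<in> points p" for P
  proof -
    have b: "bl p P \<in> blks p" "m P \<in> bl p P" using bl_in[OF wp that] m(1)[OF that] by auto
    then show mp: "m P \<in> points p" using wf_partD(1)[OF wp] by auto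
    have "bl p (m P) = bl p P" by (rule bl_eq[OF wp b])
    then have "{m P, m (m P)} = {P, m P}" using m(1)[OF mp] m(1)[OF that] by simp
    then show "m (m P) = P" using m(2)[OF that] by (auto simp: doubleton_eq_iff)
  qed
  \<comment> \<open>If all partners stayed in \<open>S\<close>, the involution \<open>m\<close>
    would pair opposite colors and the sum would vanish.\<close>
  have "\<exists>P\<in>S. m P \<notin> S"
  proof (rule ccontr)
    assume "\<not> (\<exists>P\<in>S. m P \<notin> S)"
    then have "(\<Sum>P\<in>S. sg (ncol p P)) = (\<Sum>P\<in>S. - sg (ncol p P))"
      by (intro sum.reindex_bij_witness[of _ m m]) (auto simp: mm m pts)
    then show False using nz by (simp add: sum_negf)
  qed
  then obtain P where P: "P \<in> S" "m P \<notin> S" by blast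
  define E where "E = bl p P"
  have E: "E \<in> blks p" "P \<in> E" "m P \<in> E"
    using bl_in[OF wp pts[OF P(1)]] m(1)[OF pts[OF P(1)]] by (auto simp: E_def)
  have LE: "Lev p E = i" using Lev_eq[OF p E(1,2)] P by (simp add: S_def)
  have "m P \<notin> set u2" using P(2) Lev_eq[OF p E(1,3)] LE by (simp add: S_def)
  moreover have "m P \<noteq> a" "m P \<noteq> b" "m P \<noteq> a'" "m P \<noteq> b'"
    using Lev_eq[OF p E(1,3)] LE L i by auto
  moreover have "m P \<in> set (pl p)" using mm(1)[OF pts[OF P(1)]] by simp
  \<comment> \<open>\<open>P\<close> lies between \<open>a\<close> and \<open>b\<close>. A partner
    beyond \<open>a'\<close> or before \<open>a\<close> separates the points of \<open>A\<close>; a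
    partner between \<open>b\<close> and \<open>a'\<close> separates those of
    \<open>B\<close>.\<close>
  ultimately consider "m P \<in> set u1" | "m P \<in> set u3" | "m P \<in> set (u4 @ b' # u5)"
    unfolding pl by auto
  then have "crosses p A E \<or> crosses p B E"
  proof cases
    case 1
    have "subseq [m P, a, P, a'] (pl p)"
      by (rule subseq_fourI(2)[of _ u1 a "u2 @ b # u3" a' "u4 @ b' # u5"]) (use 1 P in \<open>auto simp: pl S_def\<close>)
    then show ?thesis using crossesI(2)[of E A "m P" P a a'] E A LE i by auto
  next
    case 2
    then obtain x y where xy: "u3 = x @ m P # y" by (meson split_list)
    have "subseq [P, b, m P, b'] (u2 @ b # x @ m P # y @ a' # u4 @ b' # u5)"
    proof -
      have "P \<in> set u2" using P by (simp add: S_def)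
      then obtain z z' where "u2 = z @ P # z'" by (meson split_list)
      then show ?thesis using subseq_four[of P b "m P" b' z z' x "y @ a' # u4" u5] by simp
    qed
    then have "subseq [P, b, m P, b'] (pl p)"
      using list_emb_append2[of "(=)" _ _ "u1 @ [a]"] by (simp add: pl xy)
    then show ?thesis using crossesI(2)[of E B P "m P" b b'] E B LE i by auto
  next
    case 3
    have "subseq [a, P, a', m P] (pl p)"
      by (rule subseq_fourI(1)[of _ u1 a "u2 @ b # u3" a' "u4 @ b' # u5"]) (use 3 P in \<open>auto simp: pl S_def\<close>)
    then show ?thesis using crossesI(1)[of A E a a' P "m P"] E A LE i by auto
  qed
  then show thesis using that E(1) LE by blast
qed

text \<open>The level at distance \<open>x\<close> from \<open>A\<close> in the direction of
  \<open>B\<close> has distance \<open>y\<close> from \<open>B\<close>, so a block of that level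
  crossing either one gives the required distance.\<close>

lemma dist_split:
  assumes p: "p \<in> S0" and AB: "A \<in> blks p" "B \<in> blks p" "crosses p A B" and d: "dist p A B = x + y"
  obtains E E' where "E \<in> blks p" "E' \<in> blks p" "crosses p E E'" "dist p E E' = x \<or> dist p E E' = y"
proof (cases "x = 0 \<or> y = 0")
  case True
  \<comment> \<open>With a zero summand no level lies strictly between, but the given crossing
    itself already has distance \<open>x\<close> or \<open>y\<close>.\<close>
  then show thesis using that AB d by auto
next
  case False
  have ne: "A \<noteq> B" using AB(3) by (auto simp: crosses_def)
  have abs: "\<bar>Lev p A - Lev p B\<bar> = int x + int y" using d dist_Lev[OF p AB(1,2) ne] by linarith
  define i where "i = (if Lev p A < Lev p B then Lev p A + int x else Lev p A - int x)"
  have i: "Lev p A < i \<and> i < Lev p B \<or> Lev p B < i \<and> i < Lev p A"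
    using False abs by (auto simp: i_def)
  note wA = wf_partD(1)[OF S0_wf[OF p] AB(1)] and wB = wf_partD(1)[OF S0_wf[OF p] AB(2)]
  have i': "Lev p B < i \<and> i < Lev p A \<or> Lev p A < i \<and> i < Lev p B" using i by blast
  have "\<exists>E\<in>blks p. Lev p E = i \<and> (crosses p A E \<or> crosses p B E)"
  proof (rule crossesE[OF AB(3) wA wB])
    fix a b a' b'
    assume *: "a \<in> A" "b \<in> A" "a' \<in> B" "b' \<in> B"
    show ?thesis if "subseq [a, a', b, b'] (pl p)"
      by (rule intermediate_crossing[OF p AB(1) *(1,2) AB(2) *(3,4) that i]) blast
    show ?thesis if "subseq [a', a, b', b] (pl p)"
      by (rule intermediate_crossing[OF p AB(2) *(3,4) AB(1) *(1,2) that i']) blast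
  qed
  then obtain E where E: "E \<in> blks p" "Lev p E = i" "crosses p A E \<or> crosses p B E" by blast
  have "E \<noteq> A" "E \<noteq> B" using E i by auto
  then have "dist p A E = x" "dist p B E = y"
    using dist_Lev[OF p AB(1) E(1)] dist_Lev[OF p AB(2) E(1)] E(2) abs i by (auto simp: i_def)
  then show thesis using that E AB by blast
qed

text \<open>To contain \<open>C\<close>, the set \<open>ID D\<close> must have a \<open>D\<close>
  that avoids all crossing distances in \<open>C\<close>. The largest such \<open>D\<close> is
  taken, as it makes \<open>ID D\<close> smallest.\<close>

lemma category_eq_ID:
  assumes C: "category C" "C \<subseteq> S0"
  defines "D \<equiv> - {dist q A B | q A B. q \<in> C \<and> A \<in> blks q \<and> B \<in> blks q \<and> crosses q A B}"
  shows "subsemigroup D" "C = ID D"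
proof -
  show "subsemigroup D"
    unfolding subsemigroup_def
  proof (intro ballI)
    fix x y assume xy: "x \<in> D" "y \<in> D"
    show "x + y \<in> D"
    proof (rule ccontr)
      assume "x + y \<notin> D"
      then obtain q A B where q: "q \<in> C" "A \<in> blks q" "B \<in> blks q" "crosses q A B" "dist q A B = x + y"
        by (auto simp: D_def)
      have "q \<in> S0" using q C by auto
      then obtain E E' where "E \<in> blks q" "E' \<in> blks q" "crosses q E E'" "dist q E E' = x \<or> dist q E E' = y"
        by (rule dist_split[OF _ q(2-5)])
      then show False using xy q(1) unfolding D_def by blast
    qed
  qed
  show "C = ID D"
  proof
    show "C \<subseteq> ID D" using C by (auto simp: ID_def D_def)
    show "ID D \<subseteq> C"
    proof
      fix p assume p: "p \<in> ID D"
      then have pS: "p \<in> S0" by (simp add: ID_def)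
      show "p \<in> C"
      proof (rule mem_from_commute[OF C pS])
        fix B B' assume B: "B \<in> blks p" "B' \<in> blks p" "crosses p B B'"
        then have "dist p B B' \<notin> D" using p by (auto simp: ID_def)
        \<comment> \<open>The member \<open>q\<close> may vary with the crossing and shares only the
          distance with \<open>p\<close>; that is enough, since commutation depends only on the
          distance of levels.\<close>
        then obtain q A A' where q: "q \<in> C" "A \<in> blks q" "A' \<in> blks q" "crosses q A A'"
          and d: "dist p B B' = dist q A A'" by (auto simp: D_def)
        have qS: "q \<in> S0" using q C by auto
        interpret height_words "hom C :: (color \<times> point set option) list \<Rightarrow> _"
          by (rule height_words_hom[OF C(1)])
        have "B \<noteq> B'" "A \<noteq> A'" using B q by (auto simp: crosses_def)
        then have "\<bar>Lev p B - Lev p B'\<bar> = \<bar>Lev q A - Lev q A'\<bar>"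
          using d dist_Lev[OF pS B(1,2)] dist_Lev[OF qS q(2,3)] by (simp add: eq_nat_nat_iff)
        with commute_crossing[OF C(1) q(1) qS q(2-4)] show "commute (Lev p B) (Lev p B')"
          by (rule commute_dist)
      qed
    qed
  qed
qed

section \<open>A category of noncrossing partitions\<close>

text \<open>Labels act on \<open>\<int>\<close> by the transposition of 0 and 1, the translation by 1, and the identity.
  That the upper and the lower word of a partition act alike is preserved by composition, and no
  translation other than 0 commutes with the transposition.\<close>

datatype lab = Transpose | Translate | Ignore

text \<open>The color matters only for translations, because the transposition is its own
  inverse.\<close>

fun act :: "color \<times> lab \<Rightarrow> int \<Rightarrow> int" where
  "act (c, Transpose) x = (if x = 0 then 1 else if x = 1 then 0 else x)"
| "act (c, Translate) x = x + sg c"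
| "act (c, Ignore) x = x"

abbreviation ev :: "(color \<times> lab) list \<Rightarrow> int \<Rightarrow> int" where
  "ev \<equiv> foldr act"

lemma act_opp [simp]: "act (c, l) (act (opp c, l) x) = x" "act (opp c, l) (act (c, l) x) = x"
  by (cases l; simp)+

lemma ev_winv: "ev w (ev (winv w) x) = x"
proof (induction w arbitrary: x)
  case (Cons a w)
  obtain c l where a: "a = (c, l)" by force
  have "ev (a # w) (ev (winv (a # w)) x) = act (c, l) (ev w (ev (winv w) (act (opp c, l) x)))"
    by (simp add: a winv_Cons)
  then show ?case by (simp add: Cons)
qed simp

definition balanced :: "partition \<Rightarrow> bool" where
  "balanced p \<longleftrightarrow> (\<forall>\<phi>. block_const p \<phi> \<longrightarrow> ev (upw p \<phi>) = ev (low p \<phi>))"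

text \<open>Balance does not bound the size of blocks: a lower row \<open>[W, Bk, W, Bk]\<close>
  forming one block is balanced. Hence the size is imposed separately and has to be followed through
  compositions.\<close>

definition bal_pairs :: "partition set" where
  "bal_pairs = {p. wf_part p \<and> (\<forall>B\<in>blks p. card B = 2) \<and> balanced p}"

lemma ev_translate:
  assumes "\<And>P. P \<in> set u \<Longrightarrow> \<phi> P = (if P \<in> T then Translate else Ignore)"
  shows "ev (map (\<lambda>P. (ncol p P, \<phi> P)) u) x = x + ht (map (ncol p) (filter (\<lambda>P. P \<in> T) u))"
  using assms by (induction u) auto

lemma balanced_pl:
  assumes "balanced p" "block_const p \<phi>"
  shows "ev (map (\<lambda>P. (ncol p P, \<phi> P)) (pl p)) x = x"
proof -
  have "ev (low p \<phi>) = ev (upw p \<phi>)" using assms by (simp add: balanced_def)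
  then show ?thesis by (simp add: labelled_pl ev_winv)
qed

lemma block_const_union:
  assumes "\<And>B. B \<in> blks p \<Longrightarrow> B \<subseteq> T \<or> B \<inter> T = {}" "\<And>B. B \<in> blks p \<Longrightarrow> B \<subseteq> A \<or> B \<inter> A = {}"
  shows "block_const p (\<lambda>P. if P \<in> A then x else if P \<in> T then y else z)"
  unfolding block_const_def
proof (intro ballI)
  fix B P Q assume B: "B \<in> blks p" "P \<in> B" "Q \<in> B"
  have "P \<in> T \<longleftrightarrow> Q \<in> T" "P \<in> A \<longleftrightarrow> Q \<in> A" using assms[OF B(1)] B by auto
  then show "(if P \<in> A then x else if P \<in> T then y else z) = (if Q \<in> A then x else if Q \<in> T then y else z)"
    by simp
qed

text \<open>Translating along the blocks in \<open>T\<close> and ignoring all others makes the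
  cyclic word a translation by this height, and it must act as the identity.\<close>

lemma balanced_total:
  assumes "balanced p" "\<And>B. B \<in> blks p \<Longrightarrow> B \<subseteq> T \<or> B \<inter> T = {}"
  shows "ht (map (ncol p) (filter (\<lambda>P. P \<in> T) (pl p))) = 0"
proof -
  have "block_const p (\<lambda>P. if P \<in> {} then Ignore else if P \<in> T then Translate else Ignore)"
    by (rule block_const_union) (use assms in auto)
  from balanced_pl[OF assms(1) this, of 0] show ?thesis
    by (subst (asm) ev_translate[of _ _ T]) auto
qed

text \<open>Let \<open>A\<close> act by the transposition and \<open>T\<close> by translations. Up
  to the outer stretches, triviality of the cyclic word says that the translation along
  \<open>v\<close> commutes with the transposition.\<close>

lemma balanced_between:
  assumes "balanced p" "wf_part p" "A \<in> blks p" "A = {a, b}" "pl p = u @ a # v @ b # w"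
    and T: "\<And>B. B \<in> blks p \<Longrightarrow> B \<subseteq> T \<or> B \<inter> T = {}" "A \<inter> T = {}"
  shows "ht (map (ncol p) (filter (\<lambda>P. P \<in> T) v)) = 0"
proof -
  define \<phi> where "\<phi> P = (if P \<in> A then Transpose else if P \<in> T then Translate else Ignore)" for P
  have "block_const p \<phi>"
    unfolding \<phi>_def
  proof (rule block_const_union[OF T(1)])
    show "B \<subseteq> A \<or> B \<inter> A = {}" if "B \<in> blks p" for B
      using assms(2,3) that unfolding wf_part_def by (metis order_refl)
  qed
  note bal = balanced_pl[OF assms(1) this]
  define s where "s u = ht (map (ncol p) (filter (\<lambda>P. P \<in> T) u))" for u
  have d: "distinct (u @ a # v @ b # w)" using distinct_pl[of p] assms(5) by simp
  have tr: "ev (map (\<lambda>P. (ncol p P, \<phi> P)) xs) x = x + s xs" if "a \<notin> set xs" "b \<notin> set xs" for xs x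
    unfolding s_def using that by (intro ev_translate) (auto simp: \<phi>_def assms(4))
  define t where "t = act (W, Transpose)"
  have t: "act (c, Transpose) x = t x" for c x by (simp add: t_def)
  have ab: "\<phi> a = Transpose" "\<phi> b = Transpose" by (auto simp: \<phi>_def assms(4))
  have eq: "t (t (x + s w) + s v) + s u = x" for x
    using bal[of x] d by (simp add: assms(5) tr ab t del: act.simps)
  \<comment> \<open>The starting value is so far to the right that neither transposition moves it,
    which isolates the total translation.\<close>
  have "s v + s u + s w = 0"
    using eq[of "\<bar>s v\<bar> + 5 - s w"] by (simp add: t_def split: if_splits)
  \<comment> \<open>This starting value reaches the first transposition as 0, which becomes
    1.\<close>
  moreover have "t (1 + s v) + s u = - s w" using eq[of "- s w"] by (simp add: t_def)
  ultimately have "t (1 + s v) = s v" by linarith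
  then show ?thesis unfolding s_def[symmetric] by (auto simp: t_def split: if_splits)
qed

text \<open>Each condition is one choice of \<open>T\<close>: a single block gives opposite colors,
  the complement of a block gives arcs of height 0, and a block crossing another is refuted because
  exactly one of its points lies in the arc and contributes 1 or -1.\<close>

lemma bal_pairs_ID: "bal_pairs \<subseteq> ID UNIV"
proof
  fix p assume p: "p \<in> bal_pairs"
  then have wf: "wf_part p" and bal: "balanced p" and card: "\<And>B. B \<in> blks p \<Longrightarrow> card B = 2"
    by (auto simp: bal_pairs_def)
  have un: "B \<subseteq> B' \<or> B \<inter> B' = {}" if "B \<in> blks p" "B' \<in> blks p" for B B'
    using wf that unfolding wf_part_def by (metis order_refl)
  have opp: "ncol p b = opp (ncol p a)" if B: "B \<in> blks p" "B = {a, b}" "pl p = u @ a # v @ b # w" for B a b u v w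
  proof -
    have "distinct (u @ a # v @ b # w)" using distinct_pl[of p] B(3) by simp
    moreover have "filter (\<lambda>P. P \<in> B) xs = []" if "a \<notin> set xs" "b \<notin> set xs" for xs
      using that B(2) by (auto simp: filter_empty_conv)
    ultimately have "filter (\<lambda>P. P \<in> B) (pl p) = [a, b]" by (simp add: B(2,3))
    then have "sg (ncol p a) + sg (ncol p b) = 0"
      using balanced_total[OF bal, of B] un B(1) by simp
    then show ?thesis by (cases "ncol p a"; cases "ncol p b") auto
  qed
  have two: "(\<exists>u v w. pl p = u @ a # v @ b # w) \<or> (\<exists>u v w. pl p = u @ b # v @ a # w)"
    if "B \<in> blks p" "B = {a, b}" "a \<noteq> b" for B a b
  proof -
    have "a \<in> set (pl p)" "b \<in> set (pl p)" using wf_partD(1)[OF wf that(1)] that(2) by auto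
    then show ?thesis by (rule split_two[OF _ _ that(3)]) blast+
  qed
  have pair: "pair_nb p"
    unfolding pair_nb_def
  proof (intro conjI ballI)
    fix B assume B: "B \<in> blks p"
    then obtain a b where ab: "B = {a, b}" "a \<noteq> b" using card card_2_iff by metis
    then have "B = {b, a}" by auto
    with two[OF B ab] opp[OF B] ab have "ncol p b = opp (ncol p a) \<or> ncol p a = opp (ncol p b)"
      by blast
    then show "\<exists>\<alpha> \<beta>. B = {\<alpha>, \<beta>} \<and> ncol p \<alpha> \<noteq> ncol p \<beta>"
      using ab(1) by (metis opp_neq(1))
  qed (rule wf)
  have zero: "sigma p (cyc_open p a b) = 0 \<and> sigma p (cyc_open p b a) = 0"
    if B: "B \<in> blks p" "B = {a, b}" "pl p = u @ a # v @ b # w" for B a b u v w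
  proof -
    have d: "distinct (u @ a # v @ b # w)" using distinct_pl[of p] B(3) by simp
    have "ht (map (ncol p) (filter (\<lambda>P. P \<in> - B) v)) = 0"
      by (rule balanced_between[OF bal wf B(1-3)]) (use un[OF _ B(1)] in auto)
    moreover have "filter (\<lambda>P. P \<in> - B) v = v" using d B(2) by (auto intro: filter_True)
    ultimately have v: "ht (map (ncol p) v) = 0" by simp
    have "ht (map (ncol p) (pl p)) = 0" using balanced_total[OF bal, of UNIV] by simp
    then have "ht (map (ncol p) (u @ w)) = 0" using v opp[OF B] by (simp add: B(3))
    then show ?thesis
      using v cyc_split(1,2)[OF B(3)] sigma_set[of v p] sigma_set[of "u @ w" p] d
      by (simp add: Un_commute Int_Un_distrib)
  qed
  have "p \<in> S0"
    unfolding S0_def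
  proof (intro CollectI conjI pair ballI impI)
    fix B a b assume B: "B \<in> blks p" "a \<in> B" "b \<in> B" "a \<noteq> b"
    then have ab: "B = {a, b}" "B = {b, a}" using card[OF B(1)] by (auto simp: card_2_iff)
    show "sigma p (cyc_open p a b) = 0"
      using two[OF B(1) ab(1) B(4)] zero[OF B(1)] ab by blast
  qed
  moreover have "\<not> crosses p B B'" if B: "B \<in> blks p" "B' \<in> blks p" for B B'
  proof
    have no: False if E: "E \<in> blks p" "E' \<in> blks p" "E \<noteq> E'" "a \<in> E" "b \<in> E" "a' \<in> E'" "b' \<in> E'"
      and sub: "subseq [a, a', b, b'] (pl p)" for E E' a b a' b'
    proof -
      obtain u1 u2 u3 u4 u5 where pl: "pl p = u1 @ a # u2 @ a' # u3 @ b # u4 @ b' # u5"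
        using subseq_fourE[OF sub] by metis
      have d: "distinct (u1 @ a # u2 @ a' # u3 @ b # u4 @ b' # u5)" using distinct_pl[of p] pl by simp
      then have "a \<noteq> b" "a' \<noteq> b'" by auto
      then have E2: "E = {a, b}" "E' = {a', b'}"
        using card[OF E(1)] card[OF E(2)] E by (auto simp: card_2_iff)
      have z: "ht (map (ncol p) (filter (\<lambda>P. P \<in> E') (u2 @ a' # u3))) = 0"
        by (rule balanced_between[OF bal wf E(1) E2(1)])
          (use un[OF _ E(2)] un[OF E(1,2)] d E2 in \<open>auto simp: pl\<close>)
      have "filter (\<lambda>P. P \<in> E') xs = []" if "a' \<notin> set xs" "b' \<notin> set xs" for xs
        using that E2(2) by (auto simp: filter_empty_conv)
      then have f: "filter (\<lambda>P. P \<in> E') (u2 @ a' # u3) = [a']" using d E2(2) by simp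
      have "sg (ncol p a') = 0" using z unfolding f by simp
      then show False by (cases "ncol p a'") auto
    qed
    assume "crosses p B B'"
    then show False
    proof (rule crossesE[OF _ wf_partD(1)[OF wf B(1)] wf_partD(1)[OF wf B(2)]])
      fix a b a' b'
      assume *: "B \<noteq> B'" "a \<in> B" "b \<in> B" "a' \<in> B'" "b' \<in> B'"
      show False if "subseq [a, a', b, b'] (pl p)" by (rule no[OF B * that])
      show False if "subseq [a', a, b', b] (pl p)"
        by (rule no[OF B(2,1) *(1)[symmetric] *(4,5,2,3) that])
    qed
  qed
  ultimately show "p \<in> ID UNIV" unfolding ID_def by blast
qed

text \<open>The component of \<open>x\<close> is a path: remove its first two edges and continue at the third vertex.\<close>

lemma matching_path:
  assumes "finite F" "sym F" "sym G" "irrefl F" "irrefl G" "single_valued F" "single_valued G"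
    and "x \<in> Domain F" "x \<notin> Domain G"
  shows "\<exists>y. y \<noteq> x \<and> {z. (x, z) \<in> (F \<union> G)\<^sup>* \<and> (z \<notin> Domain F \<or> z \<notin> Domain G)} = {x, y}"
  using assms
proof (induction "card F" arbitrary: F G x rule: less_induct)
  case less
  have sF: "\<And>a b. (a, b) \<in> F \<Longrightarrow> (b, a) \<in> F" and sG: "\<And>a b. (a, b) \<in> G \<Longrightarrow> (b, a) \<in> G"
    using less.prems(2,3) by (auto dest: symD)
  have vF: "\<And>a b c. (a, b) \<in> F \<Longrightarrow> (a, c) \<in> F \<Longrightarrow> b = c" and vG: "\<And>a b c. (a, b) \<in> G \<Longrightarrow> (a, c) \<in> G \<Longrightarrow> b = c"
    using less.prems(6,7) by (auto dest: single_valuedD)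
  have iF: "\<And>a. (a, a) \<notin> F" and iG: "\<And>a. (a, a) \<notin> G"
    using less.prems(4,5) by (auto simp: irrefl_def)
  obtain y where xy: "(x, y) \<in> F" using less.prems(8) by auto
  have ne: "y \<noteq> x" using xy iF by auto
  have xG: "\<And>b. (x, b) \<notin> G" "\<And>b. (b, x) \<notin> G" using less.prems(9) sG by auto
  let ?E = "(F \<union> G)\<^sup>*"
  have Exy: "(x, y) \<in> ?E" using xy by auto
  show ?case
  proof (cases "y \<in> Domain G")
    case False
    have "z = x \<or> z = y" if "(x, z) \<in> ?E" for z
      using that by (induction rule: rtrancl_induct) (use xy xG False vF sF in blast)+
    then have "{z. (x, z) \<in> ?E \<and> (z \<notin> Domain F \<or> z \<notin> Domain G)} = {x, y}"
      using Exy False less.prems(9) by auto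
    then show ?thesis using ne by blast
  next
    case True
    then obtain z where yz: "(y, z) \<in> G" by auto
    have zne: "z \<noteq> x" "z \<noteq> y" using yz xG iG by auto
    have Exz: "(x, z) \<in> ?E" using Exy yz by (meson UnI2 rtrancl.rtrancl_into_rtrancl)
    have yF: "y \<in> Domain F" using sF[OF xy] by auto
    show ?thesis
    proof (cases "z \<in> Domain F")
      case False
      have "t = x \<or> t = y \<or> t = z" if "(x, t) \<in> ?E" for t
        using that
      proof (induction rule: rtrancl_induct)
        case (step s t)
        then consider "(s, t) \<in> F" "s = x" | "(s, t) \<in> F" "s = y" | "(s, t) \<in> G" "s = y" | "(s, t) \<in> G" "s = z"
          using False xG by auto
        then show ?case
          by cases (use vF xy vG yz sF sG in blast)+
      qed simp
      then have "{t. (x, t) \<in> ?E \<and> (t \<notin> Domain F \<or> t \<notin> Domain G)} = {x, z}"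
        using Exz False less.prems(9) True yF by auto
      then show ?thesis using zne by blast
    next
      case zF: True
      \<comment> \<open>The vertex \<open>z\<close> becomes an endpoint of the remaining graph: its
        edge in \<open>G\<close> is removed and its edge in \<open>F\<close> stays, so the induction
        hypothesis applies with the same roles.\<close>
      define F' where "F' = F - {(x, y), (y, x)}"
      define G' where "G' = G - {(y, z), (z, y)}"
      have "card F' < card F"
        unfolding F'_def using less.prems(1) xy by (intro psubset_card_mono) auto
      moreover have "finite F'" using less.prems(1) by (simp add: F'_def)
      moreover have "sym F'" "sym G'" unfolding sym_def F'_def G'_def using sF sG by blast+
      moreover have "irrefl F'" "irrefl G'" unfolding irrefl_def F'_def G'_def using iF iG by blast+
      moreover have "single_valued F'" "single_valued G'"
        using single_valued_subset[OF _ less.prems(6), of F'] single_valued_subset[OF _ less.prems(7), of G']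
        by (auto simp: F'_def G'_def)
      moreover have "z \<in> Domain F'" using zF zne by (auto simp: F'_def)
      moreover have zG': "z \<notin> Domain G'" by (auto simp: G'_def dest: vG[OF sG[OF yz]])
      ultimately obtain y' where y': "y' \<noteq> z"
        "{t. (z, t) \<in> (F' \<union> G')\<^sup>* \<and> (t \<notin> Domain F' \<or> t \<notin> Domain G')} = {z, y'}"
        using less.hyps[of F' G' z] by blast
      \<comment> \<open>\<open>x\<close> and \<open>y\<close> have no edges left, so the remaining
        component of \<open>z\<close> avoids them.\<close>
      have dom: "x \<notin> Domain F'" "y \<notin> Domain F'" "x \<notin> Domain G'" "y \<notin> Domain G'"
        using xG by (auto simp: F'_def G'_def dest: vF[OF xy] vF[OF sF[OF xy]] vG[OF yz])
      have ran: "t \<noteq> x \<and> t \<noteq> y" if "(s, t) \<in> F' \<union> G'" for s t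
      proof -
        have "(t, s) \<in> F' \<union> G'" using that sF sG unfolding F'_def G'_def by blast
        then show ?thesis using dom by auto
      qed
      have C'ne: "t \<noteq> x \<and> t \<noteq> y" if "(z, t) \<in> (F' \<union> G')\<^sup>*" for t
        using that by (cases rule: rtrancl.cases) (use zne ran in auto)
      have C'1: "(x, t) \<in> ?E" if "(z, t) \<in> (F' \<union> G')\<^sup>*" for t
      proof -
        have "F' \<union> G' \<subseteq> F \<union> G" by (auto simp: F'_def G'_def)
        then have "(z, t) \<in> ?E" using that rtrancl_mono by blast
        with Exz show ?thesis by simp
      qed
      have C'2: "t = x \<or> t = y \<or> (z, t) \<in> (F' \<union> G')\<^sup>*" if "(x, t) \<in> ?E" for t
        using that
      proof (induction rule: rtrancl_induct)
        case (step s t)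
        consider "(s, t) \<in> F' \<union> G'" | "t = x \<or> t = y \<or> t = z"
          using step.hyps(2) by (auto simp: F'_def G'_def)
        then show ?case
        proof cases
          case 1
          then have "s \<noteq> x" "s \<noteq> y" using dom by auto
          then show ?thesis using step.IH 1 by (meson rtrancl.rtrancl_into_rtrancl)
        qed auto
      qed simp
      have ends: "(t \<notin> Domain F' \<or> t \<notin> Domain G') \<longleftrightarrow> (t \<notin> Domain F \<or> t \<notin> Domain G)"
        if "t \<noteq> x" "t \<noteq> y" "t \<noteq> z" for t
        using that by (auto simp: F'_def G'_def)
      have "t \<in> {t. (x, t) \<in> ?E \<and> (t \<notin> Domain F \<or> t \<notin> Domain G)} \<longleftrightarrow> t \<in> {x, y'}" for t
      proof -
        have y'm: "t = y' \<longleftrightarrow> t \<noteq> z \<and> (z, t) \<in> (F' \<union> G')\<^sup>* \<and> (t \<notin> Domain F' \<or> t \<notin> Domain G')"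
          using y' by auto
        show ?thesis
        proof (cases "t = x \<or> t = y \<or> t = z")
          case True
          have "y' \<noteq> x" "y' \<noteq> y" using y' C'ne by auto
          moreover have "z \<in> Domain G" using sG[OF yz] by auto
          ultimately show ?thesis using True less.prems(9) \<open>y \<in> Domain G\<close> yF zF y'(1) by auto
        next
          case False
          then show ?thesis using y'm ends[of t] C'1[of t] C'2[of t] by auto
        qed
      qed
      then have "{t. (x, t) \<in> ?E \<and> (t \<notin> Domain F \<or> t \<notin> Domain G)} = {x, y'}" by blast
      moreover have "y' \<noteq> x" using y' C'ne by auto
      ultimately show ?thesis by blast
    qed
  qed
qed

section \<open>Blocks of a composition\<close>

lemma sym_conn: "sym (conn p q)"
  by (auto simp: sym_def conn_def)

lemma conn_rtrancl_sym: "(x, y) \<in> (conn p q)\<^sup>* \<Longrightarrow> (y, x) \<in> (conn p q)\<^sup>*"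
  using sym_rtrancl[OF sym_conn] by (blast dest: symD)

definition cends :: "partition \<Rightarrow> partition \<Rightarrow> cpt set" where
  "cends p q = CT ` {..<length (up q)} \<union> CB ` {..<length (lo p)}"

text \<open>The value on middle points is a dummy; only elements of \<open>cends\<close> are
  mapped.\<close>

fun endpt :: "cpt \<Rightarrow> point" where
  "endpt (CT i) = Up i" | "endpt (CB j) = Lo j" | "endpt (CM i) = Up i"

lemma points_image: "points p = Up ` {..<length (up p)} \<union> Lo ` {..<length (lo p)}"
  by (auto simp: points_def)

lemma topmap_points: "topmap ` points p = CT ` {..<length (up p)} \<union> CM ` {..<length (lo p)}"
  and botmap_points: "botmap ` points p = CM ` {..<length (up p)} \<union> CB ` {..<length (lo p)}"
  by (simp_all add: points_image image_Un image_image)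

lemma conn_range:
  assumes "wf_part p" "wf_part q" "(x, y) \<in> conn p q"
  shows "y \<in> topmap ` points q \<union> botmap ` points p"
  using assms by (cases rule: conn_cases) auto

lemma conn_ends:
  assumes wf: "wf_part p" "wf_part q" and x: "x \<in> cends p q" and y: "(x, y) \<in> (conn p q)\<^sup>*"
  shows "y = CT i \<Longrightarrow> y \<in> cends p q" "y = CB i \<Longrightarrow> y \<in> cends p q"
proof -
  have tb: "y = CT i \<Longrightarrow> y \<in> cends p q" "y = CB i \<Longrightarrow> y \<in> cends p q"
    if "y \<in> topmap ` points q \<union> botmap ` points p"
    using that by (auto simp: cends_def points_def)
  have "y = x \<or> y \<in> topmap ` points q \<union> botmap ` points p"
    using y by (cases rule: rtrancl.cases) (use conn_range[OF wf] in auto)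
  then show "y = CT i \<Longrightarrow> y \<in> cends p q" "y = CB i \<Longrightarrow> y \<in> cends p q" using x tb by auto
qed

text \<open>\<open>comp\<close> collects reachable indices without bounding them. Reachable outer
  vertices are points of the given rows, so the restriction to \<open>cends\<close> loses
  nothing.\<close>

lemma blks_comp:
  assumes wf: "wf_part p" "wf_part q"
  shows "blks (comp p q) = {endpt ` {e \<in> cends p q. (x, e) \<in> (conn p q)\<^sup>*} | x. x \<in> cends p q}"
proof -
  have "{Up i | i. (x, CT i) \<in> (conn p q)\<^sup>*} \<union> {Lo j | j. (x, CB j) \<in> (conn p q)\<^sup>*}
     = endpt ` {e \<in> cends p q. (x, e) \<in> (conn p q)\<^sup>*}" (is "?l = ?r") if x: "x \<in> cends p q" for x
  proof
    show "?l \<subseteq> ?r"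
    proof
      fix P assume "P \<in> ?l"
      then consider i where "P = Up i" "(x, CT i) \<in> (conn p q)\<^sup>*" | j where "P = Lo j" "(x, CB j) \<in> (conn p q)\<^sup>*"
        by blast
      then show "P \<in> ?r"
      proof cases
        case 1
        then show ?thesis using conn_ends(1)[OF wf x 1(2) refl] by (intro image_eqI[of _ _ "CT i"]) auto
      next
        case 2
        then show ?thesis using conn_ends(2)[OF wf x 2(2) refl] by (intro image_eqI[of _ _ "CB j"]) auto
      qed
    qed
    show "?r \<subseteq> ?l" by (auto simp: cends_def)
  qed
  then show ?thesis
    unfolding comp_def cends_def[symmetric] Setcompr_eq_image partition.simps by (rule image_cong[OF refl])
qed

lemma inj_endpt: "inj_on endpt (cends p q)"
  by (auto simp: inj_on_def cends_def)

lemma endpt_cends: "endpt ` cends p q = points (comp p q)"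
  by (auto simp: cends_def points_def image_Un image_image)

lemma wf_comp:
  assumes wf: "wf_part p" "wf_part q"
  shows "wf_part (comp p q)"
  unfolding wf_part_def blks_comp[OF wf]
proof (intro conjI ballI impI)
  show "\<Union> {endpt ` {e \<in> cends p q. (x, e) \<in> (conn p q)\<^sup>*} |x. x \<in> cends p q} = points (comp p q)"
    unfolding endpt_cends[symmetric] by auto
next
  fix B assume "B \<in> {endpt ` {e \<in> cends p q. (x, e) \<in> (conn p q)\<^sup>*} |x. x \<in> cends p q}"
  then show "B \<noteq> {}" by auto
next
  fix B B' assume B: "B \<in> {endpt ` {e \<in> cends p q. (x, e) \<in> (conn p q)\<^sup>*} |x. x \<in> cends p q}"
    "B' \<in> {endpt ` {e \<in> cends p q. (x, e) \<in> (conn p q)\<^sup>*} |x. x \<in> cends p q}" and ne: "B \<noteq> B'"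
  obtain x where x: "B = endpt ` {e \<in> cends p q. (x, e) \<in> (conn p q)\<^sup>*}" using B(1) by blast
  obtain x' where x': "B' = endpt ` {e \<in> cends p q. (x', e) \<in> (conn p q)\<^sup>*}" using B(2) by blast
  show "B \<inter> B' = {}"
  proof (rule ccontr)
    assume "B \<inter> B' \<noteq> {}"
    then obtain e e' where e: "e \<in> cends p q" "e' \<in> cends p q" "(x, e) \<in> (conn p q)\<^sup>*"
      "(x', e') \<in> (conn p q)\<^sup>*" "endpt e = endpt e'"
      unfolding x x' by (auto simp: image_iff)
    then have "e = e'" using inj_endpt by (meson inj_onD)
    then have "(x, x') \<in> (conn p q)\<^sup>*" using e conn_rtrancl_sym by (meson rtrancl_trans)
    then have "(x, t) \<in> (conn p q)\<^sup>* \<longleftrightarrow> (x', t) \<in> (conn p q)\<^sup>*" for t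
      using conn_rtrancl_sym by (meson rtrancl_trans)
    then show False using ne unfolding x x' by simp
  qed
qed

lemma inj_topmap: "inj topmap" and inj_botmap: "inj botmap"
  by (rule injI; rename_tac P Q; case_tac P; case_tac Q; simp)+

text \<open>\<open>conn\<close> relates every point to itself. Without these loops, two-point blocks
  give an irreflexive single-valued relation as \<open>matching_path\<close> requires, with the same
  components.\<close>

definition matching :: "(point \<Rightarrow> cpt) \<Rightarrow> partition \<Rightarrow> (cpt \<times> cpt) set" where
  "matching f p = {(f P, f Q) | P Q. P \<noteq> Q \<and> (\<exists>B\<in>blks p. P \<in> B \<and> Q \<in> B)}"

lemma matching_props:
  assumes f: "inj f" and wf: "wf_part p" and card: "\<forall>B\<in>blks p. card B = 2"
  shows "finite (matching f p)" "sym (matching f p)" "irrefl (matching f p)"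
    "single_valued (matching f p)" "Domain (matching f p) = f ` points p"
proof -
  have "finite (points p)" using set_pl by (metis List.finite_set)
  moreover have "matching f p \<subseteq> f ` points p \<times> f ` points p"
    using wf_partD(1)[OF wf] by (auto simp: matching_def)
  ultimately show "finite (matching f p)" by (meson finite_SigmaI finite_imageI finite_subset)
  show "sym (matching f p)" unfolding sym_def matching_def by blast
  show "irrefl (matching f p)" using f by (auto simp: irrefl_def matching_def dest: injD)
  show "single_valued (matching f p)"
  proof (rule single_valuedI)
    fix x y z assume "(x, y) \<in> matching f p" "(x, z) \<in> matching f p"
    then obtain P Q B P' Q' B' where *: "x = f P" "y = f Q" "P \<noteq> Q" "B \<in> blks p" "P \<in> B" "Q \<in> B"
      "x = f P'" "z = f Q'" "P' \<noteq> Q'" "B' \<in> blks p" "P' \<in> B'" "Q' \<in> B'"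
      unfolding matching_def by blast
    then have P: "P' = P" using f by (metis injD)
    then have "B' = B" using wf_part_eq[OF wf] * by blast
    then show "y = z" using bspec[OF card *(4)] * P by (auto simp: card_2_iff)
  qed
  show "Domain (matching f p) = f ` points p"
  proof
    show "Domain (matching f p) \<subseteq> f ` points p" using wf_partD(1)[OF wf] by (auto simp: matching_def)
    show "f ` points p \<subseteq> Domain (matching f p)"
    proof
      fix x assume "x \<in> f ` points p"
      then obtain P where P: "x = f P" "P \<in> points p" by blast
      obtain B where B: "B \<in> blks p" "P \<in> B" by (rule wf_part_block[OF wf P(2)])
      then obtain Q where "Q \<in> B" "P \<noteq> Q" using bspec[OF card B(1)] by (auto simp: card_2_iff)
      then show "x \<in> Domain (matching f p)" using B P unfolding matching_def by blast
    qed
  qed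
qed

lemma conn_matching:
  "(conn p q)\<^sup>* = (matching topmap q \<union> matching botmap p)\<^sup>*"
proof (rule rtrancl_subset)
  show "matching topmap q \<union> matching botmap p \<subseteq> conn p q"
    unfolding matching_def conn_def by blast
  show "conn p q \<subseteq> (matching topmap q \<union> matching botmap p)\<^sup>*"
  proof (rule subrelI)
    fix x y assume "(x, y) \<in> conn p q"
    then consider "x = y" | "(x, y) \<in> matching topmap q \<union> matching botmap p"
      unfolding matching_def conn_def by blast
    then show "(x, y) \<in> (matching topmap q \<union> matching botmap p)\<^sup>*" by cases auto
  qed
qed

text \<open>A middle point belongs to both matchings and a retained point to only one. A block of
  the composition is thus the set of ends of an alternating path.\<close>

lemma card_comp:
  assumes wf: "wf_part p" "wf_part q" and lu: "lo q = up p"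
    and card: "\<forall>B\<in>blks p. card B = 2" "\<forall>B\<in>blks q. card B = 2"
    and B: "B \<in> blks (comp p q)"
  shows "card B = 2"
proof -
  let ?F = "matching topmap q" and ?G = "matching botmap p"
  note F = matching_props[OF inj_topmap wf(2) card(2)] and G = matching_props[OF inj_botmap wf(1) card(1)]
  obtain x where x: "x \<in> cends p q" and B: "B = endpt ` {e \<in> cends p q. (x, e) \<in> (conn p q)\<^sup>*}"
    using B unfolding blks_comp[OF wf] by blast
  have dom: "CT i \<in> Domain ?F \<longleftrightarrow> i < length (up q)" "CB i \<in> Domain ?G \<longleftrightarrow> i < length (lo p)"
    "CM i \<in> Domain ?F \<longleftrightarrow> i < length (up p)" "CM i \<in> Domain ?G \<longleftrightarrow> i < length (up p)"
    "CT i \<notin> Domain ?G" "CB i \<notin> Domain ?F" for i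
    unfolding F(5) G(5) topmap_points botmap_points by (auto simp: lu)
  have path: "\<exists>y. y \<noteq> x \<and> {z. (x, z) \<in> (conn p q)\<^sup>* \<and> (z \<notin> Domain ?F \<or> z \<notin> Domain ?G)} = {x, y}"
  proof (cases "x \<in> CT ` {..<length (up q)}")
    case True
    then obtain i where i: "x = CT i" "i < length (up q)" by auto
    show ?thesis unfolding conn_matching
      by (rule matching_path[OF F(1,2) G(2) F(3) G(3) F(4) G(4)]) (use dom i in blast)+
  next
    case False
    then obtain i where i: "x = CB i" "i < length (lo p)" using x by (auto simp: cends_def)
    \<comment> \<open>A path starting in the lower row begins with an edge of \<open>p\<close>, so
      the matchings exchange roles.\<close>
    have "\<exists>y. y \<noteq> x \<and> {z. (x, z) \<in> (?G \<union> ?F)\<^sup>* \<and> (z \<notin> Domain ?G \<or> z \<notin> Domain ?F)} = {x, y}"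
      by (rule matching_path[OF G(1,2) F(2) G(3) F(3) G(4) F(4)]) (use dom i in blast)+
    then show ?thesis unfolding conn_matching Un_commute[of ?F] disj_commute[of "_ \<notin> Domain ?F"] .
  qed
  have iff: "z \<in> cends p q \<longleftrightarrow> z \<notin> Domain ?F \<or> z \<notin> Domain ?G" if z: "(x, z) \<in> (conn p q)\<^sup>*" for z
  proof (cases z)
    case (CT i)
    then show ?thesis using conn_ends(1)[OF wf x z] dom(5) by blast
  next
    case (CB i)
    then show ?thesis using conn_ends(2)[OF wf x z] dom(6) by blast
  next
    case (CM i)
    then have "z \<noteq> x" using x by (auto simp: cends_def)
    then obtain t where "(t, z) \<in> conn p q" using z by (auto elim: rtranclE)
    then have "i < length (up p)"
      using conn_range[OF wf, of t z] CM lu unfolding topmap_points botmap_points by auto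
    then have "z \<in> Domain ?F" "z \<in> Domain ?G" using CM dom(3,4) by blast+
    moreover have "z \<notin> cends p q" using CM by (auto simp: cends_def)
    ultimately show ?thesis by blast
  qed
  have "{e \<in> cends p q. (x, e) \<in> (conn p q)\<^sup>*}
      = {z. (x, z) \<in> (conn p q)\<^sup>* \<and> (z \<notin> Domain ?F \<or> z \<notin> Domain ?G)}"
    using iff by blast
  with path obtain y where y: "y \<noteq> x" "{e \<in> cends p q. (x, e) \<in> (conn p q)\<^sup>*} = {x, y}"
    by auto
  then have "card {e \<in> cends p q. (x, e) \<in> (conn p q)\<^sup>*} = 2" by simp
  moreover have "inj_on endpt {e \<in> cends p q. (x, e) \<in> (conn p q)\<^sup>*}"
    by (rule inj_on_subset[OF inj_endpt]) auto
  ultimately show ?thesis unfolding B by (simp add: card_image)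
qed

text \<open>A labelling of the composition extends to the middle points; loops get the label \<open>Ignore\<close>.\<close>

lemma balanced_comp:
  assumes wf: "wf_part p" "wf_part q" and lu: "lo q = up p" and bal: "balanced p" "balanced q"
  shows "balanced (comp p q)"
  unfolding balanced_def
proof (intro allI impI)
  fix \<phi> :: "point \<Rightarrow> lab" assume \<phi>: "block_const (comp p q) \<phi>"
  let ?r = "(conn p q)\<^sup>*"
  define \<psi> where "\<psi> u = (if \<exists>e\<in>cends p q. (e, u) \<in> ?r
    then \<phi> (endpt (SOME e. e \<in> cends p q \<and> (e, u) \<in> ?r)) else Ignore)" for u
  have same: "\<phi> (endpt e) = \<phi> (endpt e')" if e: "e \<in> cends p q" "e' \<in> cends p q" "(e, e') \<in> ?r" for e e'
  proof (rule block_constD[OF \<phi>])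
    show "endpt ` {t \<in> cends p q. (e, t) \<in> ?r} \<in> blks (comp p q)"
      unfolding blks_comp[OF wf] using e(1) by blast
  qed (use e in auto)
  have \<psi>1: "\<psi> u = \<phi> (endpt e)" if e: "e \<in> cends p q" "(e, u) \<in> ?r" for e u
  proof -
    let ?e = "SOME e. e \<in> cends p q \<and> (e, u) \<in> ?r"
    have "?e \<in> cends p q \<and> (?e, u) \<in> ?r"
      by (rule someI_ex) (use e in blast)
    then have "\<phi> (endpt ?e) = \<phi> (endpt e)"
      using same[OF _ e(1) rtrancl_trans[OF _ conn_rtrancl_sym[OF e(2)]]] by blast
    moreover have "\<exists>e\<in>cends p q. (e, u) \<in> ?r" using e by blast
    ultimately show ?thesis by (simp add: \<psi>_def)
  qed
  have \<psi>: "\<psi> u = \<psi> v" if uv: "(u, v) \<in> conn p q" for u v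
  proof (cases "\<exists>e\<in>cends p q. (e, u) \<in> ?r")
    case True
    then obtain e where e: "e \<in> cends p q" "(e, u) \<in> ?r" by blast
    then have "(e, v) \<in> ?r" using uv by auto
    then show ?thesis using \<psi>1 e by metis
  next
    case False
    have "(v, u) \<in> conn p q" using uv sym_conn by (meson symD)
    then have "\<not> (\<exists>e\<in>cends p q. (e, v) \<in> ?r)" using False by (meson rtrancl.rtrancl_into_rtrancl)
    then show ?thesis using False by (simp add: \<psi>_def)
  qed
  have bq: "block_const q (\<psi> \<circ> topmap)"
    unfolding block_const_def o_def
  proof (intro ballI \<psi>)
    show "(topmap P, topmap Q) \<in> conn p q" if "B \<in> blks q" "P \<in> B" "Q \<in> B" for B P Q
      unfolding conn_def using that by blast
  qed
  have bp: "block_const p (\<psi> \<circ> botmap)"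
    unfolding block_const_def o_def
  proof (intro ballI \<psi>)
    show "(botmap P, botmap Q) \<in> conn p q" if "B \<in> blks p" "P \<in> B" "Q \<in> B" for B P Q
      unfolding conn_def using that by blast
  qed
  have "\<psi> (CT i) = \<phi> (Up i)" if "i < length (up q)" for i
    using \<psi>1[of "CT i" "CT i"] that by (simp add: cends_def)
  then have "upw (comp p q) \<phi> = upw q (\<psi> \<circ> topmap)" by (simp add: upw_def)
  moreover have "\<psi> (CB i) = \<phi> (Lo i)" if "i < length (lo p)" for i
    using \<psi>1[of "CB i" "CB i"] that by (simp add: cends_def)
  then have "low (comp p q) \<phi> = low p (\<psi> \<circ> botmap)" by (simp add: low_def)
  \<comment> \<open>The middle word is shared, so balance of \<open>q\<close> and then of
    \<open>p\<close> carries the action from the top row to the bottom row.\<close>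
  moreover have "low q (\<psi> \<circ> topmap) = upw p (\<psi> \<circ> botmap)" by (simp add: upw_def low_def lu)
  ultimately show "ev (upw (comp p q) \<phi>) = ev (low (comp p q) \<phi>)"
    using bal bp bq unfolding balanced_def by metis
qed

section \<open>Closure under the category operations\<close>

lemma points_tensor:
  "points (tensor p q) = points p \<union> shift (length (up p)) (length (lo p)) ` points q"
proof -
  have "i < a + b \<longleftrightarrow> i < a \<or> (\<exists>j<b. i = j + a)" for i a b :: nat
    by presburger
  then have "{..<a + b} = {..<a} \<union> (\<lambda>j. j + a) ` {..<b}" for a b :: nat
    by (auto simp: image_iff)
  then show ?thesis by (simp add: points_image tensor_def image_Un image_image ac_simps)
qed

lemma inj_shift: "inj (shift a b)"
  by (rule injI; rename_tac P Q; case_tac P; case_tac Q; simp)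

lemma inj_swp: "inj swp"
  by (metis injI swp_swp)

lemma wf_tensor:
  assumes "wf_part p" "wf_part q"
  shows "wf_part (tensor p q)"
proof -
  let ?s = "shift (length (up p)) (length (lo p))"
  have U: "\<Union> (blks p) = points p" "\<Union> (blks q) = points q" using assms by (auto simp: wf_part_def)
  have d: "points p \<inter> ?s ` points q = {}" by (auto simp: points_def)
  have dq: "?s ` B \<inter> ?s ` B' = {}" if "B \<in> blks q" "B' \<in> blks q" "?s ` B \<noteq> ?s ` B'" for B B'
    using that assms(2) unfolding wf_part_def image_Int[OF inj_shift, symmetric] by (metis image_empty)
  have dp: "B \<inter> B' = {}" if "B \<in> blks p" "B' \<in> blks p" "B \<noteq> B'" for B B'
    using that assms(1) unfolding wf_part_def by blast
  have dpq: "B \<inter> ?s ` B' = {}" if "B \<in> blks p" "B' \<in> blks q" for B B'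
    using d wf_partD(1)[OF assms(1) that(1)] wf_partD(1)[OF assms(2) that(2)] by blast
  show ?thesis
    unfolding wf_part_def
  proof (intro conjI ballI impI)
    show "\<Union> (blks (tensor p q)) = points (tensor p q)"
      unfolding points_tensor U[symmetric] by (auto simp: tensor_def)
    show "B \<noteq> {}" if "B \<in> blks (tensor p q)" for B
      using that wf_partD(2)[OF assms(1)] wf_partD(2)[OF assms(2)] by (auto simp: tensor_def)
    show "B \<inter> B' = {}" if "B \<in> blks (tensor p q)" "B' \<in> blks (tensor p q)" "B \<noteq> B'" for B B'
    proof -
      from that(1,2) consider "B \<in> blks p" "B' \<in> blks p" | E where "B \<in> blks p" "E \<in> blks q" "B' = ?s ` E"
        | E where "E \<in> blks q" "B = ?s ` E" "B' \<in> blks p"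
        | E E' where "E \<in> blks q" "B = ?s ` E" "E' \<in> blks q" "B' = ?s ` E'"
        by (auto simp: tensor_def)
      then show ?thesis by cases (use dp dpq dq that(3) in \<open>auto simp: Int_commute\<close>)
    qed
  qed
qed

lemma wf_invol:
  assumes "wf_part p"
  shows "wf_part (invol p)"
proof -
  have U: "\<Union> (blks p) = points p" using assms by (auto simp: wf_part_def)
  have pts: "points (invol p) = swp ` points p"
    by (simp add: points_image invol_def image_Un image_image Un_commute)
  have "swp ` B \<inter> swp ` B' = {}" if "B \<in> blks p" "B' \<in> blks p" "swp ` B \<noteq> swp ` B'" for B B'
    using that assms unfolding wf_part_def image_Int[OF inj_swp, symmetric] by (metis image_empty)
  moreover have "\<Union> (blks (invol p)) = points (invol p)"
    unfolding pts U[symmetric] by (auto simp: invol_def)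
  ultimately show ?thesis
    using wf_partD(2)[OF assms] unfolding wf_part_def by (auto simp: invol_def)
qed

lemma category_bal_pairs: "category bal_pairs"
  unfolding category_def
proof (intro conjI ballI impI)
  show "bal_pairs \<subseteq> Collect wf_part" by (auto simp: bal_pairs_def)
next
  fix p q assume p: "p \<in> bal_pairs" and q: "q \<in> bal_pairs"
  have "balanced (tensor p q)"
    using p q by (auto simp: bal_pairs_def balanced_def block_const_tensor upw_tensor low_tensor)
  moreover have "\<forall>B\<in>blks (tensor p q). card B = 2"
    using p q by (auto simp: bal_pairs_def tensor_def card_image inj_on_subset[OF inj_shift])
  ultimately show "tensor p q \<in> bal_pairs"
    using p q wf_tensor by (simp add: bal_pairs_def)
next
  fix p assume p: "p \<in> bal_pairs"
  have "balanced (invol p)"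
    using p by (auto simp: bal_pairs_def balanced_def block_const_invol upw_invol low_invol)
  moreover have "\<forall>B\<in>blks (invol p). card B = 2"
    using p by (auto simp: bal_pairs_def invol_def card_image inj_on_subset[OF inj_swp])
  ultimately show "invol p \<in> bal_pairs"
    using p wf_invol by (simp add: bal_pairs_def)
next
  fix p q assume "p \<in> bal_pairs" "q \<in> bal_pairs" and lu: "lo q = up p"
  then have wf: "wf_part p" "wf_part q" and bal: "balanced p" "balanced q"
    and card: "\<forall>B\<in>blks p. card B = 2" "\<forall>B\<in>blks q. card B = 2"
    by (auto simp: bal_pairs_def)
  have "\<forall>B\<in>blks (comp p q). card B = 2" using card_comp[OF wf lu card] by blast
  then show "comp p q \<in> bal_pairs"
    using wf_comp[OF wf] balanced_comp[OF wf lu bal] by (simp add: bal_pairs_def)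
next
  have i: "idp c \<in> bal_pairs" for c
  proof -
    have "ev (upw (idp c) \<phi>) = ev (low (idp c) \<phi>)" if "block_const (idp c) \<phi>" for \<phi>
      using block_constD[OF that, of "{Up 0, Lo 0}" "Up 0" "Lo 0"] by (simp add: idp_def upw_def low_def)
    then show ?thesis by (auto simp: bal_pairs_def balanced_def wf_part_def points_def idp_def)
  qed
  show "idp W \<in> bal_pairs" "idp Bk \<in> bal_pairs" by (rule i)+
  have p: "pairp c (opp c) \<in> bal_pairs" for c
  proof -
    have "ev (upw (pairp c (opp c)) \<phi>) = ev (low (pairp c (opp c)) \<phi>)"
      if "block_const (pairp c (opp c)) \<phi>" for \<phi>
      using block_constD[OF that, of "{Lo 0, Lo 1}" "Lo 0" "Lo 1"]
      by (simp add: pairp_def upw_def low_def fun_eq_iff)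
    then show ?thesis
      by (auto simp: bal_pairs_def balanced_def wf_part_def points_def pairp_def less_Suc_eq numeral_2_eq_2)
  qed
  show "pairp W Bk \<in> bal_pairs" "pairp Bk W \<in> bal_pairs" using p[of W] p[of Bk] by simp_all
qed

text \<open>The closure conditions survive intersections; well-formedness is inherited from
  \<open>bal_pairs\<close>, which belongs to the intersected family.\<close>

lemma category_gen: "category (gen {})"
proof -
  have "gen {} \<subseteq> bal_pairs" using category_bal_pairs by (auto simp: gen_def)
  then have "gen {} \<subseteq> Collect wf_part" using category_bal_pairs by (auto simp: category_def)
  then show ?thesis unfolding category_def gen_def by auto
qed

theorem theorem2:
  shows "(\<forall>C. category C \<and> gen {} \<subseteq> C \<and> C \<subseteq> ID {} \<longrightarrow>
            (\<exists>D. subsemigroup D \<and> C = ID D))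
         \<and> gen {} = ID UNIV"
proof (intro conjI allI impI)
  have S0: "ID {} = S0" by (auto simp: ID_def)
  show "\<exists>D. subsemigroup D \<and> C = ID D" if "category C \<and> gen {} \<subseteq> C \<and> C \<subseteq> ID {}" for C
    using category_eq_ID[of C] that S0 by auto
  have sub: "gen {} \<subseteq> ID UNIV"
    using category_bal_pairs bal_pairs_ID by (auto simp: gen_def)
  moreover have anti: "ID UNIV \<subseteq> ID D" for D by (auto simp: ID_def)
  ultimately have "gen {} \<subseteq> S0" using S0 by blast
  \<comment> \<open>\<open>ID\<close> is antitone, so \<open>ID UNIV\<close> lies in
    \<open>ID D\<close> whatever \<open>D\<close> comes out; \<open>sub\<close> is the other
    inclusion.\<close>
  then obtain D where "gen {} = ID D" using category_eq_ID(2)[OF category_gen] by blast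
  with sub anti[of D] show "gen {} = ID UNIV" by blast
qed

end
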